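(* Let $\beta>0$. For each $n\ge 1$ let $\lambda_1,\dots,\lambda_n$ be the points of the Hermite $\beta$ ensemble of size $n$, i.e. real random variables with joint probability density $$p_n(x_1,\dots,x_n)=\frac{1}{Z_{n,\beta}}\prod_{i<j}|x_i-x_j|^\beta\prod_{j=1}^n e^{-\frac{\beta}{4}x_j^2},\qquad x_1,\dots,x_n\in\mathbb{R},$$ where $Z_{n,\beta}$ is the normalization constant. For $a<b$ let $N_n(a,b)$ denote the number of points $\lambda_i$ in the interval $(a,b)$. Assume that $(t_n)_{n\ge1}$ is a sequence of real numbers such that $$\frac{t_n}{\sqrt{\log n}}\to\infty,\qquad \frac{t_n}{\sqrt n}\to 0\qquad\text{as } n\to\infty.$$ Then for any $-2<x<2$ and any $\varepsilon>0$, $$P\left(\left|\frac{N_n\left(x\sqrt n,\;x\sqrt n+\frac{t_n}{\sqrt n}\right)}{t_n}-\rho_{sc}(x)\right|>\varepsilon\right)\longrightarrow 0\qquad\text{as } n\to\infty,$$ where $\rho_{sc}(x)=\frac{1}{2\pi}\sqrt{4-x^2}$ for $|x|\le 2$.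
   Context: The parameter $\beta>0$ is fixed (independent of $n$). *)

theory Defs
  imports "HOL-Probability.Probability"
begin

text \<open>Configurations of \<open>n\<close> points are functions on the index set \<^term>\<open>{1..n::nat}\<close>; the densities
  below are taken with respect to the product of \<open>n\<close> copies of Lebesgue measure.\<close>

definition hermite_weight :: "real \<Rightarrow> nat \<Rightarrow> (nat \<Rightarrow> real) \<Rightarrow> real" where
  "hermite_weight \<beta> n x =
     (\<Prod>(i, j) \<in> {(i, j). 1 \<le> i \<and> i < j \<and> j \<le> n}. \<bar>x i - x j\<bar> powr \<beta>) *
     (\<Prod>j\<in>{1..n}. exp (- (\<beta> / 4) * (x j)\<^sup>2))"

definition hermite_Z :: "real \<Rightarrow> nat \<Rightarrow> real" where
  "hermite_Z \<beta> n = (LINT x | (\<Pi>\<^sub>M i\<in>{1..n}. lborel). hermite_weight \<beta> n x)"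

definition hermite_density :: "real \<Rightarrow> nat \<Rightarrow> (nat \<Rightarrow> real) \<Rightarrow> real" where
  "hermite_density \<beta> n x = 1 / hermite_Z \<beta> n * hermite_weight \<beta> n x"

definition hermite_ensemble ::
    "real \<Rightarrow> nat \<Rightarrow> 'a measure \<Rightarrow> (nat \<Rightarrow> 'a \<Rightarrow> real) \<Rightarrow> bool" where
  "hermite_ensemble \<beta> n M \<Lambda> \<longleftrightarrow>
     prob_space M \<and>
     distributed M (\<Pi>\<^sub>M i\<in>{1..n}. lborel) (\<lambda>\<omega>. \<lambda>i\<in>{1..n}. \<Lambda> i \<omega>)
       (\<lambda>x. ennreal (hermite_density \<beta> n x))"

definition num_points :: "nat \<Rightarrow> (nat \<Rightarrow> 'a \<Rightarrow> real) \<Rightarrow> real \<Rightarrow> real \<Rightarrow> 'a \<Rightarrow> nat" where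
  "num_points n \<Lambda> a b \<omega> = card {i \<in> {1..n}. \<Lambda> i \<omega> \<in> {a<..<b}}"

text \<open>Isabelle's \<^const>\<open>sqrt\<close> is negative on negative arguments, so the support is made explicit.\<close>

definition rho_sc :: "real \<Rightarrow> real" where
  "rho_sc x = (if \<bar>x\<bar> \<le> 2 then 1 / (2 * pi) * sqrt (4 - x\<^sup>2) else 0)"

end

theory Submission imports Defs begin

text \<open>
  Everything is expressed through the Stieltjes transform
  \<open>s(w) = (1/n) (\<Sum>i. 1 / (\<lambda>\<^sub>i/sqrt n - w))\<close> of the rescaled points, which is shown to be close to
  \<open>m(x + i0)\<close>, the boundary value of the Stieltjes transform of the semicircle law, for \<open>w\<close> near \<open>x\<close> and
  heights \<open>Im w\<close> much larger than \<open>1/n\<close>.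

  Let \<open>R\<^sub>i = 1/(\<lambda>\<^sub>i - z)\<close> and \<open>S = (\<Sum>i. R\<^sub>i)\<close>. Integrating the divergence of the vector field \<open>(R\<^sub>i G)\<^sub>i\<close>
  times the density gives, for smooth observables \<open>G\<close>, the loop equation
  \<open>E [G Q] = (2/\<beta>) E [\<Sum>i. R\<^sub>i \<partial>\<^sub>i G] - (2/\<beta> - 1) E [G (\<Sum>i. R\<^sub>i\<^sup>2)]\<close> with the loop defect
  \<open>Q = S\<^sup>2 + z S + n\<close>
  (\<open>loop_equation\<close>, \<open>loop_equation_resolvent_sums\<close>). Since the logarithmic gradient of the density is
  singular on the diagonals, it is derived for a regularised density and passed to the limit.

  The decisive choice is \<open>G = cnj Q\<close>. The right-hand side then consists of error terms, which the Ward
  identity \<open>Im S = Im z (\<Sum>i. \<bar>R\<^sub>i\<bar>\<^sup>2)\<close> makes small, and one obtains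
  \<open>E \<bar>Q\<bar>\<^sup>2 \<le> C (Im z)\<^bsup>-2\<^esup> E (\<bar>S\<bar>\<^sup>2 + \<bar>z\<bar>\<^sup>2)\<close> (\<open>expected_loop_defect_bound\<close>). After rescaling, \<open>Q/n\<close> is
  \<open>s\<^sup>2 + w s + 1\<close>. For \<open>w = x\<close> this factorises as \<open>(s - m) (s - cnj m)\<close>, and
  \<open>\<bar>s - cnj m\<bar> \<ge> Im m > 0\<close> for every configuration because \<open>Im s \<ge> 0\<close>: in the bulk the quadratic
  equation is stable without any a priori information. Hence
  \<open>E \<bar>s(w) - m\<bar>\<^sup>2 = O ((n Im w)\<^bsup>-2\<^esup> + \<bar>w - x\<bar>\<^sup>2)\<close> in one step, without an induction over scales
  (\<open>emp_stieltjes_L2\<close>).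

  For the counting function, put \<open>w = x + (t/n) \<zeta>\<close> with fixed \<open>\<zeta>\<close> in the upper half plane, so that
  \<open>n Im w = t Im \<zeta>\<close> tends to infinity and \<open>w\<close> tends to \<open>x\<close>. The numbers \<open>Im s(w)\<close> are then sums of
  Poisson kernels over the points rescaled so that the counting interval becomes the unit interval.
  Smoothing the indicator function of the unit interval with the Poisson kernel of height \<open>\<kappa>\<^sup>2\<close> makes an
  error that is itself dominated by \<open>\<kappa>\<close> times three Poisson kernels (\<open>unit_interval_smoothing_error\<close>).
  So the normalised count differs from \<open>Im m / pi = rho_sc x\<close> by \<open>O(\<kappa>)\<close> in mean, and Markov's
  inequality followed by \<open>\<kappa> \<rightarrow> 0\<close> finishes the proof.
\<close>

section \<open>Integration by parts on a product space\<close>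

lemma bounded_range_iff: "bounded (range f) \<longleftrightarrow> (\<exists>B. \<forall>x. norm (f x) \<le> B)"
  by (auto simp: bounded_iff)

lemma bounded_range_const: "bounded (range (\<lambda>x. c))"
  by (auto simp: bounded_iff)

lemma bounded_range_add:
  fixes f g :: "'a \<Rightarrow> 'b::real_normed_vector"
  assumes "bounded (range f)" "bounded (range g)"
  shows "bounded (range (\<lambda>x. f x + g x))"
  using bounded_plus_comp[of f UNIV g] assms by simp

lemma bounded_range_diff:
  fixes f g :: "'a \<Rightarrow> 'b::real_normed_vector"
  assumes "bounded (range f)" "bounded (range g)"
  shows "bounded (range (\<lambda>x. f x - g x))"
  using bounded_minus_comp[of f UNIV g] assms by simp

lemma bounded_range_mult:
  fixes f g :: "'a \<Rightarrow> 'b::real_normed_algebra"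
  assumes "bounded (range f)" "bounded (range g)"
  shows "bounded (range (\<lambda>x. f x * g x))"
proof -
  obtain B C where B: "\<And>x. norm (f x) \<le> B" and C: "\<And>x. norm (g x) \<le> C"
    using assms by (auto simp: bounded_iff)
  have "norm (f x * g x) \<le> B * C" for x
    using norm_mult_ineq[of "f x" "g x"] mult_mono[OF B C] norm_ge_zero order_trans
    by (metis B)
  then show ?thesis by (auto simp: bounded_iff)
qed

lemma bounded_range_sum:
  fixes f :: "'i \<Rightarrow> 'a \<Rightarrow> 'b::real_normed_vector"
  assumes "\<And>i. i \<in> I \<Longrightarrow> bounded (range (f i))"
  shows "bounded (range (\<lambda>x. \<Sum>i\<in>I. f i x))"
  using assms
proof (induction I rule: infinite_finite_induct)
  case (insert i I)
  then show ?case using bounded_range_add[of "f i"] by simp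
qed (auto simp: bounded_iff)

lemma integrable_inverse_one_plus_square: "integrable lborel (\<lambda>t::real. 1 / (1 + t\<^sup>2))"
  using integrable_inverse_1_plus_square
  by (simp add: set_integrable_def einterval_def inverse_eq_divide)

text \<open>The bound \<open>C / (1 + t\<^sup>2)\<close> does two jobs: it makes the derivative integrable, and it makes the
  boundary terms at \<open>\<plusminus>m\<close> vanish.\<close>

lemma integral_derivative_eq_0:
  fixes F F' :: "real \<Rightarrow> complex"
  assumes deriv: "\<And>t. (F has_vector_derivative F' t) (at t)"
    and F_le: "\<And>t. norm (F t) \<le> C / (1 + t\<^sup>2)"
    and F'_le: "\<And>t. norm (F' t) \<le> C / (1 + t\<^sup>2)"
    and meas [measurable]: "F' \<in> borel_measurable lborel"
  shows "integral\<^sup>L lborel F' = 0"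
proof -
  have dom: "integrable lborel (\<lambda>t. C / (1 + t\<^sup>2))"
    using integrable_mult_right[OF integrable_inverse_one_plus_square, of C] by simp
  have int: "integrable lborel F'"
    by (rule Bochner_Integration.integrable_bound[OF dom])
       (auto intro!: AE_I2 order_trans[OF F'_le] divide_right_mono)
  have "(\<lambda>m. (LINT t|lborel. indicator {- real m..real m} t *\<^sub>R F' t)) \<longlonglongrightarrow> integral\<^sup>L lborel F'"
  proof (rule integral_dominated_convergence[OF _ _ dom])
    show "AE t in lborel. (\<lambda>m. indicator {- real m..real m} t *\<^sub>R F' t) \<longlonglongrightarrow> F' t"
    proof (rule AE_I2, rule tendsto_eventually)
      fix t :: real
      show "\<forall>\<^sub>F m in sequentially. indicator {- real m..real m} t *\<^sub>R F' t = F' t"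
        using eventually_ge_at_top[of "nat \<lceil>\<bar>t\<bar>\<rceil>"]
        by eventually_elim (auto simp: indicator_def)
    qed
    show "AE t in lborel. norm (indicator {- real m..real m} t *\<^sub>R F' t) \<le> C / (1 + t\<^sup>2)" for m
      using F'_le by (auto simp: indicator_def intro: order_trans[OF norm_ge_zero F'_le])
  qed (use borel_measurable_integrable[OF int] in measurable)
  moreover have "(LINT t|lborel. indicator {- real m..real m} t *\<^sub>R F' t) = F m - F (- real m)" for m
  proof -
    have "set_integrable lborel {- real m..real m} F'"
      unfolding set_integrable_def by (intro integrable_mult_indicator int) simp
    then have "(LINT t|lborel. indicator {- real m..real m} t *\<^sub>R F' t) = integral {- real m..real m} F'"
      using set_borel_integral_eq_integral(2) by (metis set_lebesgue_integral_def)
    also have "\<dots> = F m - F (- real m)"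
      by (intro integral_unique fundamental_theorem_of_calculus)
         (auto intro: has_vector_derivative_at_within deriv)
    finally show ?thesis .
  qed
  moreover have "(\<lambda>m. F m - F (- real m)) \<longlonglongrightarrow> 0"
  proof -
    have lim: "(\<lambda>m. C / (1 + (real m)\<^sup>2)) \<longlonglongrightarrow> 0"
      by (intro tendsto_divide_0[OF tendsto_const] filterlim_at_top_imp_at_infinity
          filterlim_tendsto_add_at_top[OF tendsto_const] filterlim_pow_at_top filterlim_real_sequentially) simp
    have "(\<lambda>m. F (real m)) \<longlonglongrightarrow> 0" "(\<lambda>m. F (- real m)) \<longlonglongrightarrow> 0"
      using F_le[of "real _"] F_le[of "- real _"]
      by (auto intro!: Lim_null_comparison[OF _ lim] always_eventually)
    from tendsto_diff[OF this] show ?thesis by simp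
  qed
  ultimately show ?thesis
    by (simp add: LIMSEQ_unique)
qed

lemma integrable_product_bound:
  fixes \<Phi> :: "('i \<Rightarrow> real) \<Rightarrow> complex"
  assumes "finite I" and meas: "\<Phi> \<in> borel_measurable (\<Pi>\<^sub>M i\<in>I. lborel)"
    and le: "\<And>x. norm (\<Phi> x) \<le> C * (\<Prod>i\<in>I. 1 / (1 + (x i)\<^sup>2))"
  shows "integrable (\<Pi>\<^sub>M i\<in>I. lborel) \<Phi>"
proof -
  interpret product_sigma_finite "\<lambda>_::'i. lborel :: real measure" ..
  have "integrable (\<Pi>\<^sub>M i\<in>I. lborel) (\<lambda>x. C * (\<Prod>i\<in>I. 1 / (1 + (x i)\<^sup>2)))"
    by (intro integrable_mult_right product_integrable_prod assms integrable_inverse_one_plus_square)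
  then show ?thesis
    by (rule Bochner_Integration.integrable_bound) (use assms in \<open>auto intro: order_trans[OF _ abs_ge_self]\<close>)
qed

text \<open>Fubini isolates the \<open>k\<close>-th coordinate, and the one-dimensional statement kills the inner integral
  for every choice of the other coordinates. Domination is by a product so that freezing the other
  coordinates again leaves a bound of the form \<open>C / (1 + t\<^sup>2)\<close>.\<close>

lemma integral_partial_derivative_eq_0:
  fixes \<Phi> \<Phi>' :: "('i \<Rightarrow> real) \<Rightarrow> complex"
  assumes fin: "finite I" and k: "k \<in> I"
    and deriv: "\<And>x t. ((\<lambda>s. \<Phi> (x(k := s))) has_vector_derivative \<Phi>' (x(k := t))) (at t)"
    and le: "\<And>x. norm (\<Phi> x) \<le> C * (\<Prod>i\<in>I. 1 / (1 + (x i)\<^sup>2))"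
    and le': "\<And>x. norm (\<Phi>' x) \<le> C * (\<Prod>i\<in>I. 1 / (1 + (x i)\<^sup>2))"
    and meas: "\<Phi>' \<in> borel_measurable (\<Pi>\<^sub>M i\<in>I. lborel)"
  shows "(LINT x|(\<Pi>\<^sub>M i\<in>I. lborel). \<Phi>' x) = 0"
proof -
  interpret product_sigma_finite "\<lambda>_::'i. lborel :: real measure" ..
  let ?J = "I - {k}"
  have I: "I = insert k ?J" using k by auto
  have meas': "\<Phi>' \<in> borel_measurable (\<Pi>\<^sub>M i\<in>insert k ?J. lborel)"
    using meas I by simp
  have int: "integrable (\<Pi>\<^sub>M i\<in>insert k ?J. lborel) \<Phi>'"
    using integrable_product_bound[OF fin meas le'] I by simp
  have "(LINT x|(\<Pi>\<^sub>M i\<in>insert k ?J. lborel). \<Phi>' x)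
      = (\<integral>x. (\<integral>t. \<Phi>' (x(k := t)) \<partial>lborel) \<partial>(\<Pi>\<^sub>M i\<in>?J. lborel))"
    using fin by (intro product_integral_insert int) auto
  also have "\<dots> = (\<integral>x. 0 \<partial>(\<Pi>\<^sub>M i\<in>?J. (lborel :: real measure)))"
  proof (rule Bochner_Integration.integral_cong[OF refl])
    fix x :: "'i \<Rightarrow> real" assume x: "x \<in> space (\<Pi>\<^sub>M i\<in>?J. lborel)"
    let ?D = "C * (\<Prod>i\<in>?J. 1 / (1 + (x i)\<^sup>2))"
    have prod: "C * (\<Prod>i\<in>I. 1 / (1 + ((x(k := t)) i)\<^sup>2)) = ?D / (1 + t\<^sup>2)" for t
      using fin by (subst I, subst prod.insert) (auto intro!: prod.cong)
    show "(\<integral>t. \<Phi>' (x(k := t)) \<partial>lborel) = 0"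
    proof (rule integral_derivative_eq_0)
      show "((\<lambda>s. \<Phi> (x(k := s))) has_vector_derivative \<Phi>' (x(k := t))) (at t)" for t
        by (rule deriv)
      show "norm (\<Phi> (x(k := t))) \<le> ?D / (1 + t\<^sup>2)" for t using le prod by metis
      show "norm (\<Phi>' (x(k := t))) \<le> ?D / (1 + t\<^sup>2)" for t using le' prod by metis
      show "(\<lambda>t. \<Phi>' (x(k := t))) \<in> borel_measurable lborel"
        using measurable_comp[OF measurable_component_update[OF x] meas'] by (simp add: comp_def)
    qed
  qed
  finally show ?thesis using I by simp
qed

section \<open>The regularised Hermite weight\<close>

definition index_pairs :: "nat \<Rightarrow> (nat \<times> nat) set" where
  "index_pairs n = {(i, j). 1 \<le> i \<and> i < j \<and> j \<le> n}"

text \<open>For \<open>\<beta> < 1\<close> the weight \<open>\<bar>x i - x j\<bar> powr \<beta>\<close> has an unbounded gradient along the diagonals, and for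
  every \<open>\<beta>\<close> its logarithmic gradient is unbounded there.
  Replacing \<open>\<bar>d\<bar>\<close> by \<open>sqrt (d\<^sup>2 + \<delta>\<^sup>2)\<close> gives a smooth weight; the case \<open>\<delta> = 0\<close> is the original one.\<close>

definition reg_weight :: "real \<Rightarrow> nat \<Rightarrow> real \<Rightarrow> (nat \<Rightarrow> real) \<Rightarrow> real" where
  "reg_weight \<beta> n \<delta> x =
     (\<Prod>(i, j)\<in>index_pairs n. ((x i - x j)\<^sup>2 + \<delta>\<^sup>2) powr (\<beta> / 2)) *
     (\<Prod>j\<in>{1..n}. exp (- (\<beta> / 4) * (x j)\<^sup>2))"

text \<open>The partial derivative of the logarithm of the regularised weight in direction \<open>k\<close>. The sum runs
  over unordered pairs, each contributing with opposite signs to its two members, so that summing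
  against functions of single coordinates produces divided differences.\<close>

definition reg_force :: "real \<Rightarrow> nat \<Rightarrow> real \<Rightarrow> nat \<Rightarrow> (nat \<Rightarrow> real) \<Rightarrow> real" where
  "reg_force \<beta> n \<delta> k x =
     (\<Sum>(i, j)\<in>index_pairs n.
        \<beta> * ((x i - x j) / ((x i - x j)\<^sup>2 + \<delta>\<^sup>2)) * (of_bool (i = k) - of_bool (j = k)))
     - \<beta> / 2 * x k"

lemma finite_index_pairs [simp, intro]: "finite (index_pairs n)"
  by (rule finite_subset[of _ "{1..n} \<times> {1..n}"]) (auto simp: index_pairs_def)

lemma index_pairsD: "(i, j) \<in> index_pairs n \<Longrightarrow> i \<in> {1..n} \<and> j \<in> {1..n} \<and> i \<noteq> j"
  by (auto simp: index_pairs_def)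

lemma sum_index_pairs_mult:
  fixes g :: "nat \<Rightarrow> 'a::comm_ring_1"
  shows "2 * (\<Sum>(i, j)\<in>index_pairs n. g i * g j) = (\<Sum>i\<in>{1..n}. g i)\<^sup>2 - (\<Sum>i\<in>{1..n}. (g i)\<^sup>2)"
proof (induction n)
  case 0
  have "index_pairs 0 = {}" by (auto simp: index_pairs_def)
  then show ?case by simp
next
  case (Suc n)
  have split: "index_pairs (Suc n) = index_pairs n \<union> (\<lambda>i. (i, Suc n)) ` {1..n}"
    by (auto simp: index_pairs_def le_Suc_eq)
  have "(\<Sum>(i, j)\<in>index_pairs (Suc n). g i * g j)
      = (\<Sum>(i, j)\<in>index_pairs n. g i * g j) + (\<Sum>i\<in>{1..n}. g i) * g (Suc n)"
    unfolding split
  proof (subst sum.union_disjoint)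
    show "index_pairs n \<inter> (\<lambda>i. (i, Suc n)) ` {1..n} = {}"
      by (auto simp: index_pairs_def)
  qed (auto simp: sum.reindex inj_on_def sum_distrib_right)
  then show ?case
    using Suc by (simp add: power2_eq_square algebra_simps)
qed

lemma hermite_weight_eq_reg_weight:
  assumes "\<beta> > 0"
  shows "hermite_weight \<beta> n x = reg_weight \<beta> n 0 x"
proof -
  have "\<bar>a\<bar> powr \<beta> = (a\<^sup>2 + 0\<^sup>2) powr (\<beta> / 2)" for a :: real
  proof -
    have "(a\<^sup>2 + 0\<^sup>2) powr (\<beta> / 2) = (\<bar>a\<bar> powr 2) powr (\<beta> / 2)" by simp
    also have "\<dots> = \<bar>a\<bar> powr \<beta>" unfolding powr_powr by simp
    finally show ?thesis by simp
  qed
  then show ?thesis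
    unfolding hermite_weight_def reg_weight_def index_pairs_def by simp
qed

lemma hermite_weight_nonzero_imp_distinct:
  assumes "\<beta> > 0" "hermite_weight \<beta> n x \<noteq> 0" "(i, j) \<in> index_pairs n"
  shows "x i - x j \<noteq> 0"
proof
  assume "x i - x j = 0"
  then have "hermite_weight \<beta> n x = 0"
    unfolding hermite_weight_eq_reg_weight[OF assms(1)] reg_weight_def
    using assms(3) by (auto intro!: prod_zero bexI[of _ "(i, j)"])
  with assms(2) show False by simp
qed

lemma reg_weight_nonneg: "reg_weight \<beta> n \<delta> x \<ge> 0"
  by (auto simp: reg_weight_def intro!: mult_nonneg_nonneg prod_nonneg)

lemma reg_weight_eq_exp:
  assumes "\<delta> > 0"
  shows "reg_weight \<beta> n \<delta> x = exp ((\<Sum>(i, j)\<in>index_pairs n. \<beta> / 2 * ln ((x i - x j)\<^sup>2 + \<delta>\<^sup>2))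
            + (\<Sum>j\<in>{1..n}. - (\<beta> / 4) * (x j)\<^sup>2))"
proof -
  have pos: "(x i - x j)\<^sup>2 + \<delta>\<^sup>2 > 0" for i j
    using assms by (simp add: add_nonneg_pos)
  then have "((x i - x j)\<^sup>2 + \<delta>\<^sup>2) powr (\<beta> / 2) = exp (\<beta> / 2 * ln ((x i - x j)\<^sup>2 + \<delta>\<^sup>2))" for i j
    by (metis less_irrefl powr_def)
  then show ?thesis
    unfolding reg_weight_def exp_add by (simp add: exp_sum split_def)
qed

lemma reg_weight_has_derivative:
  assumes "\<delta> > 0" "k \<in> {1..n}"
  shows "((\<lambda>s. reg_weight \<beta> n \<delta> (x(k := s))) has_real_derivative
           reg_force \<beta> n \<delta> k (x(k := t)) * reg_weight \<beta> n \<delta> (x(k := t))) (at t)"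
proof -
  have coord: "((\<lambda>s. (x(k := s)) i) has_real_derivative of_bool (i = k)) (at t)" for i
    by (cases "i = k") auto
  have pos: "(a - b)\<^sup>2 + \<delta>\<^sup>2 > 0" for a b :: real
    using assms by (simp add: add_nonneg_pos)
  let ?y = "x(k := t)"
  have "((\<lambda>s. (\<Sum>(i, j)\<in>index_pairs n. \<beta> / 2 * ln (((x(k := s)) i - (x(k := s)) j)\<^sup>2 + \<delta>\<^sup>2))
            + (\<Sum>j\<in>{1..n}. - (\<beta> / 4) * ((x(k := s)) j)\<^sup>2)) has_real_derivative
          (\<Sum>(i, j)\<in>index_pairs n. \<beta> / 2 * ((2 * (?y i - ?y j) * (of_bool (i = k) - of_bool (j = k)))
                / ((?y i - ?y j)\<^sup>2 + \<delta>\<^sup>2)))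
            + (\<Sum>j\<in>{1..n}. - (\<beta> / 4) * (2 * ?y j * of_bool (j = k)))) (at t)"
    unfolding split_def
  proof (intro DERIV_add DERIV_sum)
    fix p
    have "((\<lambda>s. ((x(k := s)) (fst p) - (x(k := s)) (snd p))\<^sup>2 + \<delta>\<^sup>2) has_real_derivative
        2 * (?y (fst p) - ?y (snd p)) * (of_bool (fst p = k) - of_bool (snd p = k))) (at t)"
      by (rule DERIV_cong[OF DERIV_add[OF DERIV_power[OF
            DERIV_diff[OF coord[of "fst p"] coord[of "snd p"]], where n = 2] DERIV_const]])
         (simp add: mult_ac)
    from DERIV_cmult[OF DERIV_chain2[OF DERIV_ln_divide[OF pos] this], of "\<beta> / 2"]
    show "((\<lambda>s. \<beta> / 2 * ln (((x(k := s)) (fst p) - (x(k := s)) (snd p))\<^sup>2 + \<delta>\<^sup>2)) has_real_derivative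
        \<beta> / 2 * ((2 * (?y (fst p) - ?y (snd p)) * (of_bool (fst p = k) - of_bool (snd p = k)))
                / ((?y (fst p) - ?y (snd p))\<^sup>2 + \<delta>\<^sup>2))) (at t)"
      by (rule DERIV_cong) simp
  next
    fix j
    show "((\<lambda>s. - (\<beta> / 4) * ((x(k := s)) j)\<^sup>2) has_real_derivative
        - (\<beta> / 4) * (2 * ?y j * of_bool (j = k))) (at t)"
      using DERIV_cmult[OF DERIV_power[OF coord[of j], where n = 2], of "- (\<beta> / 4)"] by (simp add: mult_ac)
  qed
  moreover have "(\<Sum>j\<in>{1..n}. - (\<beta> / 4) * (2 * ?y j * of_bool (j = k))) = - \<beta> / 2 * ?y k"
    using assms(2) by (subst sum.remove[of _ k]) (auto intro!: sum.neutral)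
  moreover have "(\<Sum>(i, j)\<in>index_pairs n. \<beta> / 2 * ((2 * (?y i - ?y j) * (of_bool (i = k) - of_bool (j = k)))
                / ((?y i - ?y j)\<^sup>2 + \<delta>\<^sup>2))) - \<beta> / 2 * ?y k = reg_force \<beta> n \<delta> k ?y"
    unfolding reg_force_def by (simp add: algebra_simps)
  ultimately have "((\<lambda>s. (\<Sum>(i, j)\<in>index_pairs n. \<beta> / 2 * ln (((x(k := s)) i - (x(k := s)) j)\<^sup>2 + \<delta>\<^sup>2))
            + (\<Sum>j\<in>{1..n}. - (\<beta> / 4) * ((x(k := s)) j)\<^sup>2)) has_real_derivative
          reg_force \<beta> n \<delta> k ?y) (at t)"
    by simp
  from DERIV_exp[THEN DERIV_chain2, OF this] show ?thesis
    unfolding reg_weight_eq_exp[OF assms(1)] by (simp add: mult.commute)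
qed

lemma reg_weight_tendsto:
  assumes "\<beta> > 0"
  shows "(\<lambda>m. reg_weight \<beta> n (1 / real (Suc m)) x) \<longlonglongrightarrow> hermite_weight \<beta> n x"
proof -
  have "(\<lambda>m. (1 / real (Suc m))\<^sup>2) \<longlonglongrightarrow> 0\<^sup>2"
    by (intro tendsto_power LIMSEQ_inverse_real_of_nat[unfolded inverse_eq_divide])
  then show ?thesis
    unfolding hermite_weight_eq_reg_weight[OF assms] reg_weight_def split_def
    by (intro tendsto_mult tendsto_prod tendsto_powr' tendsto_add tendsto_const)
       (use assms in auto)
qed

lemma reg_weight_measurable [measurable]:
  "reg_weight \<beta> n \<delta> \<in> borel_measurable (\<Pi>\<^sub>M i\<in>{1..n}. lborel)"
proof -
  have "(\<lambda>x. case p of (i, j) \<Rightarrow> ((x i - x j)\<^sup>2 + \<delta>\<^sup>2) powr (\<beta> / 2))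
      \<in> borel_measurable (\<Pi>\<^sub>M i\<in>{1..n}. lborel)" if "p \<in> index_pairs n" for p
  proof (cases p)
    case (Pair i j)
    then have [measurable]: "(\<lambda>x. x i) \<in> borel_measurable (\<Pi>\<^sub>M i\<in>{1..n}. (lborel :: real measure))"
        "(\<lambda>x. x j) \<in> borel_measurable (\<Pi>\<^sub>M i\<in>{1..n}. (lborel :: real measure))"
      using index_pairsD that by auto
    show ?thesis unfolding Pair prod.case by measurable
  qed
  then show ?thesis
    unfolding reg_weight_def by measurable
qed

text \<open>Taking logarithms, this is \<open>(K + 1) ln v \<le> \<beta>/4 v + const\<close> for \<open>v = 1 + u\<^sup>2\<close>, an instance of
  \<open>ln (\<epsilon> v) \<le> \<epsilon> v - 1\<close> with \<open>\<epsilon>\<close> tuned to the slope \<open>\<beta>/4\<close>.\<close>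

lemma gaussian_decay:
  assumes "\<beta> > 0" "K \<ge> 0"
  obtains B where "B > 0"
    "\<And>u :: real. (1 + u\<^sup>2) powr K * exp (- (\<beta> / 4) * u\<^sup>2) \<le> B / (1 + u\<^sup>2)"
proof
  define \<epsilon> where "\<epsilon> = \<beta> / (4 * (K + 1))"
  have \<epsilon>: "\<epsilon> > 0" "(K + 1) * \<epsilon> = \<beta> / 4"
    using assms by (auto simp: \<epsilon>_def field_simps)
  define c where "c = \<beta> / 4 - (K + 1) * (1 + ln \<epsilon>)"
  show "exp c > 0" by simp
  fix u :: real
  let ?v = "1 + u\<^sup>2"
  have v: "?v > 0" by (simp add: add_pos_nonneg)
  have "ln (\<epsilon> * ?v) \<le> \<epsilon> * ?v - 1"
    using v \<epsilon> by (intro ln_le_minus_one) simp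
  then have "ln ?v \<le> \<epsilon> * ?v - 1 - ln \<epsilon>"
    using v \<epsilon> by (simp add: ln_mult)
  then have "(K + 1) * ln ?v \<le> (K + 1) * (\<epsilon> * ?v - 1 - ln \<epsilon>)"
    using assms by (intro mult_left_mono) auto
  also have "\<dots> = \<beta> / 4 * ?v - (K + 1) * (1 + ln \<epsilon>)"
    using \<epsilon>(2) by (simp add: algebra_simps flip: \<epsilon>(2))
  also have "\<dots> = c + \<beta> / 4 * u\<^sup>2"
    by (simp add: c_def algebra_simps)
  finally have "K * ln ?v - \<beta> / 4 * u\<^sup>2 \<le> c - ln ?v"
    by (simp add: algebra_simps)
  then have "exp (K * ln ?v - \<beta> / 4 * u\<^sup>2) \<le> exp (c - ln ?v)"
    by simp
  moreover have "?v powr K * exp (- (\<beta> / 4) * u\<^sup>2) = exp (K * ln ?v - \<beta> / 4 * u\<^sup>2)"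
    using v by (simp add: powr_def flip: exp_add)
  moreover have "exp (c - ln ?v) = exp c / ?v"
    using v by (simp add: exp_diff)
  ultimately show "?v powr K * exp (- (\<beta> / 4) * u\<^sup>2) \<le> exp c / ?v"
    by simp
qed

text \<open>Each pair factor \<open>(x i - x j)\<^sup>2 + \<delta>\<^sup>2\<close> is at most \<open>2 (1 + (x i)\<^sup>2) (1 + (x j)\<^sup>2)\<close>, hence at most
  twice the product of all \<open>1 + (x l)\<^sup>2\<close>; the Gaussian factors absorb any power of that product.
  The constant does not depend on \<open>\<delta>\<close>, which is what dominated convergence as \<open>\<delta> \<rightarrow> 0\<close> requires.\<close>

lemma reg_weight_bound:
  assumes "\<beta> > 0"
  obtains C where "C > 0"
    "\<And>\<delta> x. \<bar>\<delta>\<bar> \<le> 1 \<Longrightarrow> reg_weight \<beta> n \<delta> x \<le> C * (\<Prod>i\<in>{1..n}. 1 / (1 + (x i)\<^sup>2))"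
proof -
  define N where "N = card (index_pairs n)"
  define K where "K = \<beta> / 2 * N"
  obtain B where B: "B > 0"
    "\<And>u :: real. (1 + u\<^sup>2) powr K * exp (- (\<beta> / 4) * u\<^sup>2) \<le> B / (1 + u\<^sup>2)"
    using gaussian_decay[OF assms, of K] assms K_def by auto
  show thesis
  proof
    show "2 powr K * B ^ n > 0" using B by simp
    fix \<delta> :: real and x :: "nat \<Rightarrow> real" assume \<delta>: "\<bar>\<delta>\<bar> \<le> 1"
    define P where "P = (\<Prod>i\<in>{1..n}. 1 + (x i)\<^sup>2)"
    have P1: "P \<ge> 1" unfolding P_def by (rule prod_ge_1) simp
    have pair: "((x i - x j)\<^sup>2 + \<delta>\<^sup>2) \<le> 2 * P" if "(i, j) \<in> index_pairs n" for i j
    proof -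
      have "\<delta>\<^sup>2 \<le> 1" using \<delta> by (simp add: abs_square_le_1)
      moreover have "(x i - x j)\<^sup>2 + 1 \<le> 2 * ((1 + (x i)\<^sup>2) * (1 + (x j)\<^sup>2))"
      proof -
        have "2 * ((1 + (x i)\<^sup>2) * (1 + (x j)\<^sup>2)) - ((x i - x j)\<^sup>2 + 1)
            = 1 + (x i + x j)\<^sup>2 + 2 * (x i * x j)\<^sup>2"
          by (simp add: power2_eq_square algebra_simps)
        also have "\<dots> \<ge> 0" by simp
        finally show ?thesis by simp
      qed
      moreover have "(1 + (x i)\<^sup>2) * (1 + (x j)\<^sup>2) = (\<Prod>l\<in>{i, j}. 1 + (x l)\<^sup>2)"
        using index_pairsD[OF that] by simp
      moreover have "(\<Prod>l\<in>{i, j}. 1 + (x l)\<^sup>2) \<le> P"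
        unfolding P_def using index_pairsD[OF that] by (intro prod_mono2) auto
      ultimately show ?thesis by linarith
    qed
    have "(\<Prod>(i, j)\<in>index_pairs n. ((x i - x j)\<^sup>2 + \<delta>\<^sup>2) powr (\<beta> / 2))
        \<le> (\<Prod>p\<in>index_pairs n. (2 * P) powr (\<beta> / 2))"
      using assms pair by (intro prod_mono) (auto intro!: powr_mono2)
    also have "\<dots> = (2 * P) powr K"
      using P1 by (simp add: K_def N_def powr_power mult.commute)
    also have "\<dots> = 2 powr K * (\<Prod>i\<in>{1..n}. (1 + (x i)\<^sup>2) powr K)"
      using P1 by (simp add: powr_mult P_def prod_powr_distrib)
    finally have "reg_weight \<beta> n \<delta> x
        \<le> 2 powr K * (\<Prod>i\<in>{1..n}. (1 + (x i)\<^sup>2) powr K) * (\<Prod>j\<in>{1..n}. exp (- (\<beta> / 4) * (x j)\<^sup>2))"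
      unfolding reg_weight_def by (intro mult_right_mono prod_nonneg) auto
    also have "\<dots> = 2 powr K * (\<Prod>i\<in>{1..n}. (1 + (x i)\<^sup>2) powr K * exp (- (\<beta> / 4) * (x i)\<^sup>2))"
      by (simp add: prod.distrib)
    also have "\<dots> \<le> 2 powr K * (\<Prod>i\<in>{1..n}. B / (1 + (x i)\<^sup>2))"
      using B(2) by (intro mult_left_mono prod_mono) auto
    also have "\<dots> = 2 powr K * B ^ n * (\<Prod>i\<in>{1..n}. 1 / (1 + (x i)\<^sup>2))"
      by (simp add: prod_dividef)
    finally show "reg_weight \<beta> n \<delta> x \<le> 2 powr K * B ^ n * (\<Prod>i\<in>{1..n}. 1 / (1 + (x i)\<^sup>2))" .
  qed
qed

lemma hermite_weight_measurable [measurable]: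
  assumes "\<beta> > 0"
  shows "hermite_weight \<beta> n \<in> borel_measurable (\<Pi>\<^sub>M i\<in>{1..n}. lborel)"
  using reg_weight_measurable[of \<beta> n 0] by (simp add: hermite_weight_eq_reg_weight[OF assms] cong: measurable_cong)

lemma hermite_weight_nonneg: "\<beta> > 0 \<Longrightarrow> hermite_weight \<beta> n x \<ge> 0"
  by (simp add: hermite_weight_eq_reg_weight reg_weight_nonneg)

lemma integrable_bounded_mult_hermite_weight:
  fixes f :: "(nat \<Rightarrow> real) \<Rightarrow> complex"
  assumes "\<beta> > 0" "bounded (range f)" "f \<in> borel_measurable (\<Pi>\<^sub>M i\<in>{1..n}. lborel)"
  shows "integrable (\<Pi>\<^sub>M i\<in>{1..n}. lborel) (\<lambda>x. f x * complex_of_real (hermite_weight \<beta> n x))"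
proof -
  note [measurable] = assms(3) hermite_weight_measurable[OF assms(1)]
  obtain B where B: "\<And>x. norm (f x) \<le> B" using assms(2) by (auto simp: bounded_iff)
  obtain C where C: "\<And>x. hermite_weight \<beta> n x \<le> C * (\<Prod>i\<in>{1..n}. 1 / (1 + (x i)\<^sup>2))"
    using reg_weight_bound[OF assms(1), of n thesis] hermite_weight_eq_reg_weight[OF assms(1)]
    by (metis abs_zero zero_le_one)
  have "norm (f x * complex_of_real (hermite_weight \<beta> n x)) \<le> B * C * (\<Prod>i\<in>{1..n}. 1 / (1 + (x i)\<^sup>2))" for x
    using mult_mono[OF B[of x] C[of x] order_trans[OF norm_ge_zero B[of x]] hermite_weight_nonneg[OF assms(1)]]
    by (simp add: norm_mult hermite_weight_nonneg[OF assms(1)] mult.assoc)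
  moreover have "(\<lambda>x. f x * complex_of_real (hermite_weight \<beta> n x)) \<in> borel_measurable (\<Pi>\<^sub>M i\<in>{1..n}. lborel)"
    by measurable
  ultimately show ?thesis
    by (intro integrable_product_bound) auto
qed

section \<open>The loop equation\<close>

definition resolvent :: "complex \<Rightarrow> real \<Rightarrow> complex" where
  "resolvent z y = 1 / (complex_of_real y - z)"

lemma divide_le_1: "0 \<le> a \<Longrightarrow> a \<le> b \<Longrightarrow> a / b \<le> (1 :: real)"
  by (cases "b = 0") (auto simp: divide_le_eq_1)

lemma resolvent_denominator:
  assumes "Im z > 0"
  shows "complex_of_real y - z \<noteq> 0" "norm (complex_of_real y - z) \<ge> Im z"
proof -
  have "\<bar>Im (complex_of_real y - z)\<bar> \<le> norm (complex_of_real y - z)"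
    by (rule abs_Im_le_cmod)
  then show "norm (complex_of_real y - z) \<ge> Im z"
    using assms by simp
  then show "complex_of_real y - z \<noteq> 0" using assms by auto
qed

lemma norm_resolvent_le:
  assumes "Im z > 0" shows "norm (resolvent z y) \<le> 1 / Im z"
  using resolvent_denominator[OF assms, of y] assms
  by (auto simp: resolvent_def norm_divide intro!: divide_left_mono mult_pos_pos)

text \<open>Through this identity the Gaussian drift \<open>x k\<close>, unbounded by itself, enters the loop equation only
  in a bounded combination.\<close>

lemma mult_resolvent:
  assumes "Im z > 0" shows "complex_of_real y * resolvent z y = 1 + z * resolvent z y"
  using resolvent_denominator[OF assms, of y] by (simp add: resolvent_def field_simps)

text \<open>The divided difference of a resolvent factorises. This is what turns the pair interaction into
  the square of a single sum, and it cancels the singularity on the diagonal.\<close>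

lemma resolvent_diff:
  assumes "Im z > 0"
  shows "resolvent z y - resolvent z y' = - of_real (y - y') * (resolvent z y * resolvent z y')"
  using resolvent_denominator[OF assms] by (simp add: resolvent_def field_simps)

lemma Im_resolvent:
  assumes "Im z > 0" shows "Im (resolvent z y) = Im z * (norm (resolvent z y))\<^sup>2"
proof -
  have "norm (resolvent z y) = 1 / norm (complex_of_real y - z)"
    by (simp add: resolvent_def norm_divide)
  then show ?thesis
    by (simp add: resolvent_def Im_divide cmod_power2 power_divide)
qed

lemma resolvent_has_vector_derivative:
  assumes "Im z > 0"
  shows "(resolvent z has_vector_derivative - (resolvent z t)\<^sup>2) (at t)"
proof -
  have "((\<lambda>w. 1 / (w - z)) has_field_derivative - (resolvent z t)\<^sup>2) (at (of_real t))"
    using resolvent_denominator[OF assms, of t]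
    by (auto intro!: derivative_eq_intros simp: resolvent_def power2_eq_square)
  then show ?thesis
    unfolding resolvent_def [abs_def]
    by (rule has_vector_derivative_real_field[unfolded o_def])
qed

lemma resolvent_coordinate_derivative:
  assumes "Im z > 0"
  shows "((\<lambda>s. resolvent z ((x(k := s)) i)) has_vector_derivative
          - of_bool (i = k) * (resolvent z ((x(k := t)) i))\<^sup>2) (at t)"
  using resolvent_has_vector_derivative[OF assms] by (cases "i = k") auto

lemma resolvent_measurable [measurable]: "resolvent z \<in> borel_measurable borel"
  unfolding resolvent_def [abs_def] by measurable

lemma bounded_resolvent:
  assumes "Im z > 0" shows "bounded (range (\<lambda>x. resolvent z (x k)))"
  using norm_resolvent_le[OF assms] by (auto simp: bounded_iff)

lemma bounded_mult_resolvent: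
  assumes "Im z > 0" shows "bounded (range (\<lambda>x. of_real (x k) * resolvent z (x k)))"
  unfolding mult_resolvent[OF assms]
  by (intro bounded_range_add bounded_range_mult bounded_resolvent assms) (auto simp: bounded_iff)

text \<open>Test functions for the loop equation: bounded, with bounded partial derivatives \<open>G' k\<close>. The
  derivative is a parameter so that it can be used as a measurable function of the configuration.\<close>

locale smooth_observable =
  fixes n :: nat and G :: "(nat \<Rightarrow> real) \<Rightarrow> complex" and G' :: "nat \<Rightarrow> (nat \<Rightarrow> real) \<Rightarrow> complex"
  assumes G_deriv: "\<And>k x t. k \<in> {1..n} \<Longrightarrow>
      ((\<lambda>s. G (x(k := s))) has_vector_derivative G' k (x(k := t))) (at t)"
    and G_bounded: "bounded (range G)"
    and G'_bounded: "\<And>k. k \<in> {1..n} \<Longrightarrow> bounded (range (G' k))"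
    and G_measurable [measurable]: "G \<in> borel_measurable (\<Pi>\<^sub>M i\<in>{1..n}. lborel)"
    and G'_measurable: "\<And>k. k \<in> {1..n} \<Longrightarrow> G' k \<in> borel_measurable (\<Pi>\<^sub>M i\<in>{1..n}. lborel)"
begin

lemma coordinate_measurable:
  "k \<in> {1..n} \<Longrightarrow> (\<lambda>x. x k) \<in> borel_measurable (\<Pi>\<^sub>M i\<in>{1..n}. (lborel :: real measure))"
  by simp

text \<open>The divergence of the vector field with components \<open>resolvent z (x k) * G x\<close> times the regularised
  weight, divided by that weight and written in bounded terms: the drift appears as
  \<open>x k * resolvent z (x k)\<close> and each pair interaction as a product of two resolvents with a factor
  in \<open>[0, 1]\<close>.\<close>

definition reg_divergence :: "real \<Rightarrow> complex \<Rightarrow> real \<Rightarrow> (nat \<Rightarrow> real) \<Rightarrow> complex" where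
  "reg_divergence \<beta> z \<delta> x =
     (\<Sum>k\<in>{1..n}. resolvent z (x k) * G' k x - (resolvent z (x k))\<^sup>2 * G x)
     - of_real (\<beta> / 2) * G x * (\<Sum>k\<in>{1..n}. of_real (x k) * resolvent z (x k))
     - of_real \<beta> * G x * (\<Sum>(i, j)\<in>index_pairs n.
         of_real ((x i - x j)\<^sup>2 / ((x i - x j)\<^sup>2 + \<delta>\<^sup>2)) * (resolvent z (x i) * resolvent z (x j)))"

text \<open>Each coordinate contributes the integral of a partial derivative, hence \<open>0\<close>; for \<open>\<delta> > 0\<close> that
  derivative is a bounded function times the weight, which provides the domination required for Fubini.\<close>

lemma integral_reg_divergence:
  assumes "\<beta> > 0" "Im z > 0" "\<delta> > 0" "\<delta> \<le> 1"
  shows "(LINT x|(\<Pi>\<^sub>M i\<in>{1..n}. lborel). reg_divergence \<beta> z \<delta> x * of_real (reg_weight \<beta> n \<delta> x)) = 0"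
proof -
  let ?M = "\<Pi>\<^sub>M i\<in>{1..n}. (lborel :: real measure)"
  let ?R = "resolvent z"
  note [measurable] = coordinate_measurable G'_measurable
  obtain C where C: "C > 0" "\<And>x. reg_weight \<beta> n \<delta> x \<le> C * (\<Prod>i\<in>{1..n}. 1 / (1 + (x i)\<^sup>2))"
    using reg_weight_bound[OF assms(1)] assms(3,4) by (metis abs_of_pos)
  define q :: "nat \<times> nat \<Rightarrow> nat \<Rightarrow> (nat \<Rightarrow> real) \<Rightarrow> real" where
    "q = (\<lambda>(i, j) k x. \<beta> * ((x i - x j) / ((x i - x j)\<^sup>2 + \<delta>\<^sup>2)) * (of_bool (i = k) - of_bool (j = k)))"
  define h where "h = (\<lambda>k x. ?R (x k) * G' k x - (?R (x k))\<^sup>2 * G x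
      - of_real (\<beta> / 2) * G x * (of_real (x k) * ?R (x k))
      + G x * (\<Sum>p\<in>index_pairs n. of_real (q p k x) * ?R (x k)))"
  have force: "reg_force \<beta> n \<delta> k x = (\<Sum>p\<in>index_pairs n. q p k x) - \<beta> / 2 * x k" for k x
    by (simp add: reg_force_def q_def split_def)
  have h_eq: "h k x = ?R (x k) * G' k x - (?R (x k))\<^sup>2 * G x + ?R (x k) * G x * of_real (reg_force \<beta> n \<delta> k x)" for k x
    unfolding h_def force by (simp add: algebra_simps sum_distrib_left sum_distrib_right)
  have q_bounded: "bounded (range (\<lambda>x. complex_of_real (q p k x)))" for p k
  proof -
    obtain i j where p: "p = (i, j)" by (cases p)
    have "\<bar>d / (d\<^sup>2 + \<delta>\<^sup>2)\<bar> \<le> 1 / \<delta>" for d :: real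
    proof -
      have "\<bar>d\<bar> * \<delta> \<le> d\<^sup>2 + \<delta>\<^sup>2"
        using sum_squares_bound[of "\<bar>d\<bar>" \<delta>] assms(3) mult_nonneg_nonneg[of "\<bar>d\<bar>" \<delta>]
        unfolding power2_abs by linarith
      moreover have "0 < d\<^sup>2 + \<delta>\<^sup>2"
        using assms(3) by (simp add: add_nonneg_pos)
      ultimately show ?thesis
        using assms(3) by (simp add: abs_divide divide_le_eq le_divide_eq)
    qed
    then have "norm (complex_of_real (q p k x)) \<le> \<beta> * (1 / \<delta>) * 1" for x
      unfolding p q_def prod.case norm_of_real abs_mult
      using assms by (intro mult_mono) (auto intro: mult_nonneg_nonneg)
    then show ?thesis by (auto simp: bounded_iff)
  qed
  have zero: "integrable ?M (\<lambda>x. h k x * of_real (reg_weight \<beta> n \<delta> x)) \<and>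
      (LINT x|?M. h k x * of_real (reg_weight \<beta> n \<delta> x)) = 0" if k: "k \<in> {1..n}" for k
  proof -
    have "bounded (range (\<lambda>x. of_real (\<beta> / 2) * G x))"
      by (intro bounded_range_mult G_bounded bounded_range_const)
    from bounded_range_mult[OF this bounded_mult_resolvent[OF assms(2)]]
    have "bounded (range (\<lambda>x. of_real (\<beta> / 2) * G x * (of_real (x k) * ?R (x k))))" .
    moreover have "bounded (range (\<lambda>x. ?R (x k) * G' k x - (?R (x k))\<^sup>2 * G x))"
      unfolding power2_eq_square
      by (intro bounded_range_diff bounded_range_mult bounded_resolvent G_bounded G'_bounded assms k)
    moreover have "bounded (range (\<lambda>x. G x * (\<Sum>p\<in>index_pairs n. of_real (q p k x) * ?R (x k))))"
      by (intro bounded_range_sum bounded_range_mult bounded_resolvent G_bounded q_bounded assms)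
    ultimately have "bounded (range (h k))"
      unfolding h_def using bounded_range_add bounded_range_diff by blast
    moreover have "bounded (range (\<lambda>x. ?R (x k) * G x))"
      by (intro bounded_range_mult bounded_resolvent G_bounded assms)
    ultimately obtain B B' where "\<And>x. norm (h k x) \<le> B" "\<And>x. norm (?R (x k) * G x) \<le> B'"
      by (auto simp: bounded_iff)
    then obtain D where D: "\<And>x. norm (h k x) \<le> D" "\<And>x. norm (?R (x k) * G x) \<le> D"
      by (metis max.cobounded1 max.cobounded2 order_trans)
    have le: "norm (f x * complex_of_real (reg_weight \<beta> n \<delta> x)) \<le> D * C * (\<Prod>i\<in>{1..n}. 1 / (1 + (x i)\<^sup>2))"
      if "\<And>x. norm (f x) \<le> D" for x and f :: "(nat \<Rightarrow> real) \<Rightarrow> complex"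
      using mult_mono[OF that[of x] C(2)[of x] order_trans[OF norm_ge_zero that[of x]] reg_weight_nonneg]
      by (simp add: norm_mult reg_weight_nonneg mult.assoc)
    have [measurable]: "q p k \<in> borel_measurable ?M" if "p \<in> index_pairs n" for p
    proof (cases p)
      case (Pair i j)
      note ij = index_pairsD[OF that[unfolded Pair]]
      have [measurable]: "(\<lambda>x. x i) \<in> borel_measurable ?M" "(\<lambda>x. x j) \<in> borel_measurable ?M"
        using coordinate_measurable ij by blast+
      show ?thesis unfolding Pair q_def prod.case by measurable
    qed
    have meas: "(\<lambda>x. h k x * of_real (reg_weight \<beta> n \<delta> x)) \<in> borel_measurable ?M"
      unfolding h_def using k by measurable
    have deriv: "((\<lambda>s. ?R ((x(k := s)) k) * G (x(k := s)) * of_real (reg_weight \<beta> n \<delta> (x(k := s))))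
        has_vector_derivative h k (x(k := t)) * of_real (reg_weight \<beta> n \<delta> (x(k := t)))) (at t)" for x t
    proof -
      have R: "((\<lambda>s. ?R ((x(k := s)) k)) has_vector_derivative - (?R ((x(k := t)) k))\<^sup>2) (at t)"
        using resolvent_coordinate_derivative[OF assms(2), of x k k t] by simp
      have W: "((\<lambda>s. complex_of_real (reg_weight \<beta> n \<delta> (x(k := s)))) has_vector_derivative
          of_real (reg_force \<beta> n \<delta> k (x(k := t)) * reg_weight \<beta> n \<delta> (x(k := t)))) (at t)"
        by (rule has_vector_derivative_of_real)
           (use reg_weight_has_derivative[OF assms(3) k] in \<open>simp add: has_real_derivative_iff_has_vector_derivative\<close>)
      show ?thesis
        using has_vector_derivative_mult[OF has_vector_derivative_mult[OF R G_deriv[OF k]] W]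
        by (simp add: h_eq algebra_simps)
    qed
    note h_le = le[of "h k", OF D(1)]
    note Phi_le = le[of "\<lambda>x. ?R (x k) * G x", OF D(2)]
    show ?thesis
      using integrable_product_bound[OF finite_atLeastAtMost meas h_le]
        integral_partial_derivative_eq_0[OF finite_atLeastAtMost k deriv Phi_le h_le meas] by blast
  qed
  have "reg_divergence \<beta> z \<delta> x = (\<Sum>k\<in>{1..n}. h k x)" for x
  proof -
    \<comment> \<open>Only the two members of the pair feel the force, with opposite signs.\<close>
    have pair: "(\<Sum>k\<in>{1..n}. of_real (q p k x) * ?R (x k)) = (case p of (i, j) \<Rightarrow>
        - of_real \<beta> * (of_real ((x i - x j)\<^sup>2 / ((x i - x j)\<^sup>2 + \<delta>\<^sup>2)) * (?R (x i) * ?R (x j))))"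
      if "p \<in> index_pairs n" for p
    proof (cases p)
      case (Pair i j)
      let ?c = "complex_of_real (\<beta> * ((x i - x j) / ((x i - x j)\<^sup>2 + \<delta>\<^sup>2)))"
      have ij: "i \<in> {1..n}" "j \<in> {1..n}" using index_pairsD that Pair by auto
      have expand: "complex_of_real (c * (a - b)) * r = of_real c * (of_real a * r) - of_real c * (of_real b * r)"
        for a b c r by (simp add: algebra_simps)
      have delta: "(\<Sum>k\<in>{1..n}. complex_of_real (of_bool (l = k)) * ?R (x k)) = ?R (x l)"
        if "l \<in> {1..n}" for l
        using that by (subst sum.remove[of _ l]) (auto intro!: sum.neutral)
      have pull: "complex_of_real (\<beta> * (d / D)) * (- of_real d * r) = - of_real \<beta> * (of_real (d\<^sup>2 / D) * r)"
        for d D r by (simp add: power2_eq_square)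
      have "(\<Sum>k\<in>{1..n}. of_real (q p k x) * ?R (x k)) = ?c * (?R (x i) - ?R (x j))"
        unfolding Pair q_def prod.case expand sum_subtractf sum_distrib_left[symmetric] delta[OF ij(1)] delta[OF ij(2)]
        by (rule right_diff_distrib[symmetric])
      also have "\<dots> = - of_real \<beta> * (of_real ((x i - x j)\<^sup>2 / ((x i - x j)\<^sup>2 + \<delta>\<^sup>2)) * (?R (x i) * ?R (x j)))"
        unfolding resolvent_diff[OF assms(2)] by (rule pull)
      finally show ?thesis by (simp add: Pair)
    qed
    have "(\<Sum>k\<in>{1..n}. \<Sum>p\<in>index_pairs n. of_real (q p k x) * ?R (x k))
        = (\<Sum>p\<in>index_pairs n. case p of (i, j) \<Rightarrow>
        - of_real \<beta> * (of_real ((x i - x j)\<^sup>2 / ((x i - x j)\<^sup>2 + \<delta>\<^sup>2)) * (?R (x i) * ?R (x j))))"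
      by (subst sum.swap) (intro sum.cong refl pair)
    then show ?thesis
      unfolding reg_divergence_def h_def sum.distrib sum_subtractf
      by (simp add: sum_distrib_left[symmetric] sum_negf split_def mult.left_commute[of _ "G x"] mult.assoc)
         (simp add: sum_distrib_left split_def mult_ac sum_negf)
  qed
  then have "(LINT x|?M. reg_divergence \<beta> z \<delta> x * of_real (reg_weight \<beta> n \<delta> x))
      = (LINT x|?M. (\<Sum>k\<in>{1..n}. h k x * of_real (reg_weight \<beta> n \<delta> x)))"
    by (simp add: sum_distrib_right)
  also have "\<dots> = 0"
    using zero by (subst Bochner_Integration.integral_sum) auto
  finally show ?thesis .
qed

text \<open>The limit \<open>\<delta> \<rightarrow> 0\<close>. The divergence stays bounded uniformly in \<open>\<delta>\<close>. Off the diagonals everything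
  converges. On a diagonal the interaction factor \<open>d\<^sup>2 / (d\<^sup>2 + \<delta>\<^sup>2)\<close> is \<open>0\<close>, for \<open>\<delta> = 0\<close> by the
  convention \<open>0 / 0 = 0\<close>, but the weight tends to \<open>0\<close> there, so its value is irrelevant.\<close>

lemma loop_equation:
  assumes "\<beta> > 0" "Im z > 0"
  shows "(LINT x|(\<Pi>\<^sub>M i\<in>{1..n}. lborel). reg_divergence \<beta> z 0 x * of_real (hermite_weight \<beta> n x)) = 0"
proof -
  let ?M = "\<Pi>\<^sub>M i\<in>{1..n}. (lborel :: real measure)"
  let ?R = "resolvent z"
  let ?\<delta> = "\<lambda>m. 1 / real (Suc m)"
  note [measurable] = coordinate_measurable G'_measurable
  obtain C where C: "C > 0" "\<And>\<delta> x. \<bar>\<delta>\<bar> \<le> 1 \<Longrightarrow> reg_weight \<beta> n \<delta> x \<le> C * (\<Prod>i\<in>{1..n}. 1 / (1 + (x i)\<^sup>2))"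
    using reg_weight_bound[OF assms(1)] by blast
  define A where "A = (\<lambda>x. (\<Sum>k\<in>{1..n}. ?R (x k) * G' k x - (?R (x k))\<^sup>2 * G x)
     - of_real (\<beta> / 2) * G x * (\<Sum>k\<in>{1..n}. of_real (x k) * ?R (x k)))"
  define P where "P = (\<lambda>\<delta> x. \<Sum>(i, j)\<in>index_pairs n.
         complex_of_real ((x i - x j)\<^sup>2 / ((x i - x j)\<^sup>2 + \<delta>\<^sup>2)) * (?R (x i) * ?R (x j)))"
  have div: "reg_divergence \<beta> z \<delta> x = A x - of_real \<beta> * G x * P \<delta> x" for \<delta> x
    by (simp add: reg_divergence_def A_def P_def)
  have "bounded (range (\<lambda>x. of_real (\<beta> / 2) * G x))"
    by (intro bounded_range_mult G_bounded bounded_range_const)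
  from bounded_range_mult[OF this bounded_range_sum[OF bounded_mult_resolvent[OF assms(2)]]]
  have "bounded (range (\<lambda>x. of_real (\<beta> / 2) * G x * (\<Sum>k\<in>{1..n}. of_real (x k) * ?R (x k))))" .
  moreover have "bounded (range (\<lambda>x. \<Sum>k\<in>{1..n}. ?R (x k) * G' k x - (?R (x k))\<^sup>2 * G x))"
    unfolding power2_eq_square
    by (intro bounded_range_sum bounded_range_diff bounded_range_mult bounded_resolvent
          G_bounded G'_bounded assms)
  ultimately have "bounded (range A)"
    unfolding A_def using bounded_range_diff by blast
  then obtain B1 where B1: "\<And>x. norm (A x) \<le> B1" by (auto simp: bounded_iff)
  obtain B2 where B2: "\<And>x. norm (G x) \<le> B2" using G_bounded by (auto simp: bounded_iff)
  have P_le: "norm (P \<delta> x) \<le> real (card (index_pairs n)) * (1 / Im z * (1 / Im z))" for \<delta> x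
    unfolding P_def
  proof (rule sum_norm_bound, clarify)
    fix i j
    have "(x i - x j)\<^sup>2 / ((x i - x j)\<^sup>2 + \<delta>\<^sup>2) \<le> 1"
      by (rule divide_le_1) auto
    then have "norm (complex_of_real ((x i - x j)\<^sup>2 / ((x i - x j)\<^sup>2 + \<delta>\<^sup>2)) * (?R (x i) * ?R (x j)))
        \<le> 1 * (1 / Im z * (1 / Im z))"
      unfolding norm_mult using assms(2)
      by (intro mult_mono norm_resolvent_le) (auto simp del: of_real_divide of_real_power of_real_add)
    then show "norm (complex_of_real ((x i - x j)\<^sup>2 / ((x i - x j)\<^sup>2 + \<delta>\<^sup>2)) * (?R (x i) * ?R (x j)))
        \<le> 1 / Im z * (1 / Im z)" by simp
  qed
  define D where "D = B1 + \<beta> * B2 * (real (card (index_pairs n)) * (1 / Im z * (1 / Im z)))"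
  have div_le: "norm (reg_divergence \<beta> z \<delta> x) \<le> D" for \<delta> x
  proof -
    have "norm (reg_divergence \<beta> z \<delta> x) \<le> norm (A x) + \<beta> * norm (G x) * norm (P \<delta> x)"
      using norm_triangle_ineq4[of "A x" "of_real \<beta> * G x * P \<delta> x"] assms(1)
      by (simp add: div norm_mult)
    also have "\<dots> \<le> D"
      unfolding D_def using assms(1) order_trans[OF norm_ge_zero B2]
      by (intro add_mono B1 mult_mono B2 P_le) auto
    finally show ?thesis .
  qed
  have meas: "(\<lambda>x. reg_divergence \<beta> z \<delta> x * of_real (reg_weight \<beta> n \<delta> x)) \<in> borel_measurable ?M" for \<delta>
  proof -
    have [measurable]: "P \<delta> \<in> borel_measurable ?M"
      unfolding P_def
    proof (rule borel_measurable_sum)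
      fix p assume p: "p \<in> index_pairs n"
      show "(\<lambda>x. case p of (i, j) \<Rightarrow>
          complex_of_real ((x i - x j)\<^sup>2 / ((x i - x j)\<^sup>2 + \<delta>\<^sup>2)) * (?R (x i) * ?R (x j))) \<in> borel_measurable ?M"
      proof (cases p)
        case (Pair i j)
        note ij = index_pairsD[OF p[unfolded Pair]]
        have [measurable]: "(\<lambda>x. x i) \<in> borel_measurable ?M" "(\<lambda>x. x j) \<in> borel_measurable ?M"
          using coordinate_measurable ij by blast+
        show ?thesis unfolding Pair prod.case by measurable
      qed
    qed
    have [measurable]: "A \<in> borel_measurable ?M"
      unfolding A_def by measurable
    show ?thesis unfolding div by measurable
  qed
  have prod_le: "norm (reg_divergence \<beta> z \<delta> x * of_real (reg_weight \<beta> n \<delta> x))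
      \<le> D * (C * (\<Prod>i\<in>{1..n}. 1 / (1 + (x i)\<^sup>2)))" if "\<bar>\<delta>\<bar> \<le> 1" for \<delta> x
    using mult_mono[OF div_le C(2)[OF that] order_trans[OF norm_ge_zero div_le] reg_weight_nonneg]
    by (simp add: norm_mult reg_weight_nonneg)
  have lim: "(\<lambda>m. reg_divergence \<beta> z (?\<delta> m) x * of_real (reg_weight \<beta> n (?\<delta> m) x))
      \<longlonglongrightarrow> reg_divergence \<beta> z 0 x * of_real (hermite_weight \<beta> n x)" for x
  proof (cases "hermite_weight \<beta> n x = 0")
    case True
    have "(\<lambda>m. D * reg_weight \<beta> n (?\<delta> m) x) \<longlonglongrightarrow> D * 0"
      using reg_weight_tendsto[OF assms(1), of n x] True by (intro tendsto_mult tendsto_const) simp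
    then have lim0: "(\<lambda>m. D * reg_weight \<beta> n (?\<delta> m) x) \<longlonglongrightarrow> 0" by simp
    have "norm (reg_divergence \<beta> z \<delta> x * of_real (reg_weight \<beta> n \<delta> x)) \<le> D * reg_weight \<beta> n \<delta> x" for \<delta>
      by (simp add: norm_mult reg_weight_nonneg mult_right_mono div_le)
    then have "(\<lambda>m. reg_divergence \<beta> z (?\<delta> m) x * of_real (reg_weight \<beta> n (?\<delta> m) x)) \<longlonglongrightarrow> 0"
      by (intro Lim_null_comparison[OF _ lim0] always_eventually allI)
    then show ?thesis using True by simp
  next
    case False
    note distinct = hermite_weight_nonzero_imp_distinct[OF assms(1) False]
    have sq: "(\<lambda>m. (?\<delta> m)\<^sup>2) \<longlonglongrightarrow> 0\<^sup>2"
      by (intro tendsto_power LIMSEQ_inverse_real_of_nat[unfolded inverse_eq_divide])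
    have "(\<lambda>m. P (?\<delta> m) x) \<longlonglongrightarrow> P 0 x"
      unfolding P_def split_def
      by (intro tendsto_sum tendsto_mult tendsto_of_real tendsto_divide tendsto_add tendsto_const sq)
         (use distinct in auto)
    then show ?thesis
      unfolding div by (intro tendsto_mult tendsto_diff tendsto_const tendsto_of_real reg_weight_tendsto assms)
  qed
  interpret product_sigma_finite "\<lambda>_::nat. lborel :: real measure" ..
  have "(\<lambda>m. LINT x|?M. reg_divergence \<beta> z (?\<delta> m) x * of_real (reg_weight \<beta> n (?\<delta> m) x))
      \<longlonglongrightarrow> (LINT x|?M. reg_divergence \<beta> z 0 x * of_real (hermite_weight \<beta> n x))"
  proof (rule integral_dominated_convergence)
    show "integrable ?M (\<lambda>x. D * (C * (\<Prod>i\<in>{1..n}. 1 / (1 + (x i)\<^sup>2))))"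
      by (intro integrable_mult_right product_integrable_prod integrable_inverse_one_plus_square) auto
    show "AE x in ?M. norm (reg_divergence \<beta> z (?\<delta> m) x * complex_of_real (reg_weight \<beta> n (?\<delta> m) x))
        \<le> D * (C * (\<Prod>i\<in>{1..n}. 1 / (1 + (x i)\<^sup>2)))" for m
      by (intro AE_I2 prod_le) simp
    show "(\<lambda>x. reg_divergence \<beta> z 0 x * of_real (hermite_weight \<beta> n x)) \<in> borel_measurable ?M"
      using meas[of 0] by (simp add: hermite_weight_eq_reg_weight[OF assms(1)])
  qed (use lim meas in auto)
  then show ?thesis
    using integral_reg_divergence[OF assms] by (simp add: LIMSEQ_const_iff)
qed

end

context smooth_observable
begin

text \<open>On the support of the weight the points are distinct, so all interaction factors equal \<open>1\<close> and
  the double sum is a polynomial in the sums of \<open>r k\<close> and \<open>(r k)\<^sup>2\<close>, where \<open>r k\<close> is the resolvent at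
  \<open>x k\<close>.\<close>

lemma loop_equation_resolvent_sums:
  assumes "\<beta> > 0" "Im z > 0"
  shows "(LINT x|(\<Pi>\<^sub>M i\<in>{1..n}. lborel).
    ((\<Sum>k\<in>{1..n}. resolvent z (x k) * G' k x)
     - G x * (of_real (\<beta> / 2) * ((\<Sum>k\<in>{1..n}. resolvent z (x k))\<^sup>2 + z * (\<Sum>k\<in>{1..n}. resolvent z (x k)) + of_nat n)
         + of_real (1 - \<beta> / 2) * (\<Sum>k\<in>{1..n}. (resolvent z (x k))\<^sup>2))) * of_real (hermite_weight \<beta> n x)) = 0"
    (is "(LINT x|_. ?F x * _ x) = 0")
proof -
  have "?F x * of_real (hermite_weight \<beta> n x) = reg_divergence \<beta> z 0 x * of_real (hermite_weight \<beta> n x)" for x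
  proof (cases "hermite_weight \<beta> n x = 0")
    case False
    define r where "r = (\<lambda>k. resolvent z (x k))"
    note distinct = hermite_weight_nonzero_imp_distinct[OF assms(1) False]
    have pairs: "(\<Sum>(i, j)\<in>index_pairs n. of_real ((x i - x j)\<^sup>2 / ((x i - x j)\<^sup>2 + 0\<^sup>2)) * (r i * r j))
        = (\<Sum>(i, j)\<in>index_pairs n. r i * r j)"
      using distinct by (intro sum.cong refl) auto
    have pairs2: "of_real \<beta> * G x * (\<Sum>(i, j)\<in>index_pairs n. r i * r j)
        = of_real (\<beta> / 2) * G x * ((\<Sum>k\<in>{1..n}. r k)\<^sup>2 - (\<Sum>k\<in>{1..n}. (r k)\<^sup>2))"
      unfolding sum_index_pairs_mult[symmetric] by simp
    have lin: "(\<Sum>k\<in>{1..n}. of_real (x k) * r k) = of_nat n + z * (\<Sum>k\<in>{1..n}. r k)"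
      unfolding r_def mult_resolvent[OF assms(2)] by (simp add: sum.distrib sum_distrib_left)
    have "reg_divergence \<beta> z 0 x = (\<Sum>k\<in>{1..n}. r k * G' k x) - (\<Sum>k\<in>{1..n}. (r k)\<^sup>2) * G x
        - of_real (\<beta> / 2) * G x * (of_nat n + z * (\<Sum>k\<in>{1..n}. r k))
        - of_real (\<beta> / 2) * G x * ((\<Sum>k\<in>{1..n}. r k)\<^sup>2 - (\<Sum>k\<in>{1..n}. (r k)\<^sup>2))"
      unfolding reg_divergence_def r_def[symmetric] fun_cong[OF r_def, symmetric] pairs pairs2 lin
      by (simp add: sum_subtractf sum_distrib_right)
    also have "\<dots> = ?F x"
      unfolding r_def of_real_diff of_real_1 by (simp add: algebra_simps)
    finally show ?thesis by simp
  qed simp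
  then show ?thesis using loop_equation[OF assms] by (simp only:)
qed

end

section \<open>Second moment of the loop defect\<close>

definition stieltjes_sum :: "nat \<Rightarrow> complex \<Rightarrow> (nat \<Rightarrow> real) \<Rightarrow> complex" where
  "stieltjes_sum n z x = (\<Sum>k\<in>{1..n}. resolvent z (x k))"

text \<open>The expectation of this quantity vanishes to leading order in the loop equation with constant
  test function. Dividing by \<open>n\<close> and rescaling turns it into \<open>s\<^sup>2 + w s + 1\<close>, whose zero in the upper
  half plane is the Stieltjes transform of the semicircle law.\<close>

definition loop_defect :: "nat \<Rightarrow> complex \<Rightarrow> (nat \<Rightarrow> real) \<Rightarrow> complex" where
  "loop_defect n z x = (stieltjes_sum n z x)\<^sup>2 + z * stieltjes_sum n z x + of_nat n"

lemma stieltjes_sum_measurable [measurable]: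
  "stieltjes_sum n z \<in> borel_measurable (\<Pi>\<^sub>M i\<in>{1..n}. lborel)"
  unfolding stieltjes_sum_def [abs_def] by measurable

lemma loop_defect_measurable [measurable]:
  "loop_defect n z \<in> borel_measurable (\<Pi>\<^sub>M i\<in>{1..n}. lborel)"
  unfolding loop_defect_def [abs_def] by measurable

lemma norm_stieltjes_sum_le:
  assumes "Im z > 0" shows "norm (stieltjes_sum n z x) \<le> n / Im z"
proof -
  have "norm (stieltjes_sum n z x) \<le> of_nat (card {1..n}) * (1 / Im z)"
    unfolding stieltjes_sum_def by (intro sum_norm_bound norm_resolvent_le assms)
  then show ?thesis by simp
qed

lemma bounded_stieltjes_sum:
  assumes "Im z > 0" shows "bounded (range (stieltjes_sum n z))"
  using norm_stieltjes_sum_le[OF assms] by (auto simp: bounded_iff)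

lemma bounded_loop_defect:
  assumes "Im z > 0" shows "bounded (range (loop_defect n z))"
  unfolding loop_defect_def [abs_def] power2_eq_square
  by (intro bounded_range_add bounded_range_mult bounded_stieltjes_sum bounded_range_const assms)

text \<open>The Ward identity \<open>Im S = Im z * (\<Sum>k. \<bar>r k\<bar>\<^sup>2)\<close>. A sum of squares of
  resolvents is thus controlled by the first power of \<open>S\<close>.\<close>

lemma sum_norm_resolvent_power2:
  assumes "Im z > 0"
  shows "(\<Sum>k\<in>{1..n}. (norm (resolvent z (x k)))\<^sup>2) \<le> norm (stieltjes_sum n z x) / Im z"
proof -
  have "Im (stieltjes_sum n z x) = Im z * (\<Sum>k\<in>{1..n}. (norm (resolvent z (x k)))\<^sup>2)"
    unfolding stieltjes_sum_def by (simp add: Im_resolvent[OF assms] sum_distrib_left)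
  moreover have "Im (stieltjes_sum n z x) \<le> norm (stieltjes_sum n z x)"
    using abs_Im_le_cmod abs_ge_self order_trans by blast
  ultimately show ?thesis using assms by (simp add: field_simps)
qed

lemma stieltjes_sum_coordinate_derivative:
  assumes "Im z > 0" "k \<in> {1..n}"
  shows "((\<lambda>s. stieltjes_sum n z (x(k := s))) has_vector_derivative
          - (resolvent z ((x(k := t)) k))\<^sup>2) (at t)"
proof -
  have "((\<lambda>s. stieltjes_sum n z (x(k := s))) has_vector_derivative
          (\<Sum>i\<in>{1..n}. - of_bool (i = k) * (resolvent z ((x(k := t)) i))\<^sup>2)) (at t)"
    unfolding stieltjes_sum_def
    by (intro has_vector_derivative_sum resolvent_coordinate_derivative assms)
  moreover have "(\<Sum>i\<in>{1..n}. - of_bool (i = k) * (resolvent z ((x(k := t)) i))\<^sup>2)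
      = - (resolvent z ((x(k := t)) k))\<^sup>2"
    using assms(2) by (subst sum.remove[of _ k]) (auto intro!: sum.neutral)
  ultimately show ?thesis by simp
qed

lemma loop_defect_coordinate_derivative:
  assumes "Im z > 0" "k \<in> {1..n}"
  shows "((\<lambda>s. loop_defect n z (x(k := s))) has_vector_derivative
          - (2 * stieltjes_sum n z (x(k := t)) + z) * (resolvent z ((x(k := t)) k))\<^sup>2) (at t)"
proof -
  note D = stieltjes_sum_coordinate_derivative[OF assms, of x t]
  show ?thesis
    unfolding loop_defect_def power2_eq_square[of "stieltjes_sum _ _ _"]
    by (rule has_vector_derivative_eq_rhs[OF has_vector_derivative_add[OF has_vector_derivative_add[OF
          has_vector_derivative_mult[OF D D] has_vector_derivative_mult_right[OF D]] has_vector_derivative_const]])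
       (simp add: algebra_simps)
qed

lemma smooth_observable_cnj_loop_defect:
  assumes "Im z > 0"
  shows "smooth_observable n (\<lambda>x. cnj (loop_defect n z x))
    (\<lambda>k x. cnj (- (2 * stieltjes_sum n z x + z) * (resolvent z (x k))\<^sup>2))"
proof
  fix k x t assume "k \<in> {1..n}"
  from has_vector_derivative_cnj[OF loop_defect_coordinate_derivative[OF assms this, of x t]]
  show "((\<lambda>s. cnj (loop_defect n z (x(k := s)))) has_vector_derivative
      cnj (- (2 * stieltjes_sum n z (x(k := t)) + z) * (resolvent z ((x(k := t)) k))\<^sup>2)) (at t)" .
next
  show "bounded (range (\<lambda>x. cnj (loop_defect n z x)))"
    using bounded_loop_defect[OF assms] by (simp add: bounded_iff)
next
  fix k :: nat
  have "bounded (range (\<lambda>x. (0 - (2 * stieltjes_sum n z x + z)) * (resolvent z (x k))\<^sup>2))"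
    unfolding power2_eq_square
    by (intro bounded_range_add bounded_range_diff bounded_range_mult bounded_stieltjes_sum
          bounded_resolvent bounded_range_const assms)
  then show "bounded (range (\<lambda>x. cnj (- (2 * stieltjes_sum n z x + z) * (resolvent z (x k))\<^sup>2)))"
    by (simp only: bounded_range_iff complex_mod_cnj diff_0)
next
  have [measurable]: "cnj \<in> borel_measurable borel"
    by (intro borel_measurable_continuous_onI continuous_intros)
  show "(\<lambda>x. cnj (loop_defect n z x)) \<in> borel_measurable (\<Pi>\<^sub>M i\<in>{1..n}. lborel)"
    by measurable
  fix k assume "k \<in> {1..n}"
  then have [measurable]: "(\<lambda>x. x k) \<in> borel_measurable (\<Pi>\<^sub>M i\<in>{1..n}. (lborel :: real measure))"
    by simp
  show "(\<lambda>x. cnj (- (2 * stieltjes_sum n z x + z) * (resolvent z (x k))\<^sup>2))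
      \<in> borel_measurable (\<Pi>\<^sub>M i\<in>{1..n}. lborel)"
    by measurable
qed

text \<open>The constant produced by the two applications of Young's inequality in the next lemma.\<close>

definition loop_const :: "real \<Rightarrow> real" where
  "loop_const \<beta> = 4 / \<beta> * ((1 - \<beta> / 2)\<^sup>2 / \<beta> + 3)"

text \<open>The loop equation with the test function \<open>G = cnj Q\<close>, where \<open>Q\<close> is the loop defect. The main term
  becomes \<open>\<beta>/2 \<bar>Q\<bar>\<^sup>2\<close>. The derivative term is at most \<open>\<bar>2 S + z\<bar> * (\<Sum>k. \<bar>r k\<bar>\<^sup>3)\<close> and the term with
  \<open>1 - \<beta>/2\<close> is at most a multiple of \<open>\<bar>Q\<bar> * (\<Sum>k. \<bar>r k\<bar>\<^sup>2)\<close>; by the Ward identity both are of the order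
  \<open>(Im z)\<^bsup>-2\<^esup>\<close> times squares of \<open>S\<close> and \<open>z\<close>, after half of the main term has absorbed \<open>\<bar>Q\<bar>\<close>.\<close>

lemma weighted_loop_defect_bound:
  assumes "\<beta> > 0" "Im z > 0"
  shows "(LINT x|(\<Pi>\<^sub>M i\<in>{1..n}. lborel). (norm (loop_defect n z x))\<^sup>2 * hermite_weight \<beta> n x)
    \<le> (LINT x|(\<Pi>\<^sub>M i\<in>{1..n}. lborel).
        loop_const \<beta> / (Im z)\<^sup>2 * ((norm (stieltjes_sum n z x))\<^sup>2 + (norm z)\<^sup>2) * hermite_weight \<beta> n x)"
proof -
  let ?M = "\<Pi>\<^sub>M i\<in>{1..n}. (lborel :: real measure)"
  let ?w = "hermite_weight \<beta> n"
  define \<eta> where "\<eta> = Im z"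
  have \<eta>: "\<eta> > 0" using assms by (simp add: \<eta>_def)
  define S Q where "S = stieltjes_sum n z" and "Q = loop_defect n z"
  define G' where "G' = (\<lambda>k x. cnj (- (2 * S x + z) * (resolvent z (x k))\<^sup>2))"
  interpret smooth_observable n "\<lambda>x. cnj (Q x)" G'
    unfolding G'_def S_def Q_def by (rule smooth_observable_cnj_loop_defect) fact
  define F where "F = (\<lambda>x. (\<Sum>k\<in>{1..n}. resolvent z (x k) * G' k x)
     - cnj (Q x) * (of_real (\<beta> / 2) * Q x
         + of_real (1 - \<beta> / 2) * (\<Sum>k\<in>{1..n}. (resolvent z (x k))\<^sup>2)))"
  have zero: "(LINT x|?M. F x * of_real (?w x)) = 0"
    using loop_equation_resolvent_sums[OF assms]
    unfolding F_def Q_def loop_defect_def stieltjes_sum_def by simp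
  define C where "C = loop_const \<beta> / \<eta>\<^sup>2"
  define h where "h = (\<lambda>x. C * ((norm (S x))\<^sup>2 + (norm z)\<^sup>2))"
  have Re_F: "Re (F x) \<le> \<beta> / 4 * (h x - (norm (Q x))\<^sup>2)" for x
  proof -
    let ?r = "\<lambda>k. norm (resolvent z (x k))"
    have T: "(\<Sum>k\<in>{1..n}. (?r k)\<^sup>2) \<le> norm (S x) / \<eta>"
      unfolding S_def \<eta>_def by (rule sum_norm_resolvent_power2) fact
    \<comment> \<open>The derivative term: one resolvent is bounded by \<open>1/\<eta>\<close>, the other two are summed by the Ward identity.\<close>
    have "norm (\<Sum>k\<in>{1..n}. resolvent z (x k) * G' k x) \<le> (\<Sum>k\<in>{1..n}. 1 / \<eta> * (norm (2 * S x + z) * (?r k)\<^sup>2))"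
    proof (rule sum_norm_le)
      fix k
      have "norm (resolvent z (x k) * G' k x) = ?r k * (norm (2 * S x + z) * (?r k)\<^sup>2)"
        unfolding G'_def by (simp only: norm_mult complex_mod_cnj norm_power norm_minus_cancel)
      also have "\<dots> \<le> 1 / \<eta> * (norm (2 * S x + z) * (?r k)\<^sup>2)"
        using norm_resolvent_le[OF assms(2)] by (intro mult_right_mono) (auto simp: \<eta>_def)
      finally show "norm (resolvent z (x k) * G' k x) \<le> 1 / \<eta> * (norm (2 * S x + z) * (?r k)\<^sup>2)" .
    qed
    also have "\<dots> = 1 / \<eta> * (norm (2 * S x + z) * (\<Sum>k\<in>{1..n}. (?r k)\<^sup>2))"
      by (simp add: sum_distrib_left)
    also have "\<dots> \<le> 1 / \<eta> * ((2 * norm (S x) + norm z) * (norm (S x) / \<eta>))"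
      using \<eta> norm_triangle_ineq[of "2 * S x" z]
      by (intro mult_left_mono mult_mono T) (auto simp: norm_mult intro: sum_nonneg)
    also have "\<dots> = (2 * (norm (S x))\<^sup>2 + norm z * norm (S x)) / \<eta>\<^sup>2"
      by (simp add: power2_eq_square field_simps)
    also have "\<dots> \<le> 3 * ((norm (S x))\<^sup>2 + (norm z)\<^sup>2) / \<eta>\<^sup>2"
    proof (intro divide_right_mono)
      show "2 * (norm (S x))\<^sup>2 + norm z * norm (S x) \<le> 3 * ((norm (S x))\<^sup>2 + (norm z)\<^sup>2)"
      proof -
        have "2 * a\<^sup>2 + b * a \<le> 3 * (a\<^sup>2 + b\<^sup>2)" for a b :: real
        proof -
          have "0 \<le> (a - b / 2)\<^sup>2 + 11 / 4 * b\<^sup>2" by simp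
          also have "\<dots> = 3 * (a\<^sup>2 + b\<^sup>2) - (2 * a\<^sup>2 + b * a)"
            by (simp add: power2_eq_square field_simps)
          finally show ?thesis by simp
        qed
        then show ?thesis .
      qed
    qed simp
    finally have first: "Re (\<Sum>k\<in>{1..n}. resolvent z (x k) * G' k x) \<le> 3 * ((norm (S x))\<^sup>2 + (norm z)\<^sup>2) / \<eta>\<^sup>2"
      using complex_Re_le_cmod order_trans by blast
    let ?P = "cnj (Q x) * (of_real (1 - \<beta> / 2) * (\<Sum>k\<in>{1..n}. (resolvent z (x k))\<^sup>2))"
    define a where "a = \<bar>1 - \<beta> / 2\<bar> * norm (S x) / \<eta>"
    have "norm ?P \<le> norm (Q x) * (\<bar>1 - \<beta> / 2\<bar> * (norm (S x) / \<eta>))"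
      unfolding norm_mult complex_mod_cnj norm_of_real
      by (intro mult_left_mono order_trans[OF norm_sum]) (auto simp: norm_power intro: T[simplified])
    also have "\<dots> = norm (Q x) * a" by (simp add: a_def)
    also have "\<dots> \<le> \<beta> / 4 * (norm (Q x))\<^sup>2 + a\<^sup>2 / \<beta>"
    proof -
      have "0 \<le> (\<beta> / 2 * norm (Q x) - a)\<^sup>2 / \<beta>" using assms by simp
      also have "\<dots> = \<beta> / 4 * (norm (Q x))\<^sup>2 + a\<^sup>2 / \<beta> - norm (Q x) * a"
        using assms(1) by (simp add: power2_eq_square field_simps)
      finally show ?thesis by simp
    qed
    also have "a\<^sup>2 / \<beta> \<le> (1 - \<beta> / 2)\<^sup>2 / \<beta> * ((norm (S x))\<^sup>2 + (norm z)\<^sup>2) / \<eta>\<^sup>2"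
    proof -
      have "a\<^sup>2 / \<beta> = (1 - \<beta> / 2)\<^sup>2 / \<beta> * (norm (S x))\<^sup>2 / \<eta>\<^sup>2"
        by (simp add: a_def power_mult_distrib power_divide)
      also have "\<dots> \<le> (1 - \<beta> / 2)\<^sup>2 / \<beta> * ((norm (S x))\<^sup>2 + (norm z)\<^sup>2) / \<eta>\<^sup>2"
        using assms(1) by (intro divide_right_mono mult_left_mono) auto
      finally show ?thesis .
    qed
    finally have second: "- Re ?P \<le> \<beta> / 4 * (norm (Q x))\<^sup>2
        + (1 - \<beta> / 2)\<^sup>2 / \<beta> * ((norm (S x))\<^sup>2 + (norm z)\<^sup>2) / \<eta>\<^sup>2"
      using abs_Re_le_cmod[of ?P] by linarith
    have "cnj (Q x) * (of_real (\<beta> / 2) * Q x) = of_real (\<beta> / 2 * (norm (Q x))\<^sup>2)"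
      using complex_norm_square[of "Q x"] by (simp add: mult_ac)
    then have "Re (F x) = Re (\<Sum>k\<in>{1..n}. resolvent z (x k) * G' k x) - \<beta> / 2 * (norm (Q x))\<^sup>2 - Re ?P"
      unfolding F_def distrib_left by (simp only: minus_complex.simps plus_complex.simps Re_complex_of_real)
    also have "\<dots> \<le> ((1 - \<beta> / 2)\<^sup>2 / \<beta> + 3) * ((norm (S x))\<^sup>2 + (norm z)\<^sup>2) / \<eta>\<^sup>2 - \<beta> / 4 * (norm (Q x))\<^sup>2"
      using first second by (simp add: distrib_right add_divide_distrib)
    also have "\<dots> = \<beta> / 4 * (h x - (norm (Q x))\<^sup>2)"
    proof -
      have const: "(1 - \<beta> / 2)\<^sup>2 / \<beta> + 3 = \<beta> / 4 * loop_const \<beta>"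
        using assms(1) by (simp add: loop_const_def)
      show ?thesis
        unfolding const h_def C_def by (simp add: algebra_simps add_divide_distrib)
    qed
    finally show ?thesis .
  qed
  have [measurable]: "S \<in> borel_measurable ?M" "Q \<in> borel_measurable ?M"
    unfolding S_def Q_def by (rule stieltjes_sum_measurable loop_defect_measurable)+
  have S_bdd: "bounded (range S)" and Q_bdd: "bounded (range Q)"
    unfolding S_def Q_def by (intro bounded_stieltjes_sum bounded_loop_defect assms)+
  have real_int: "integrable ?M (\<lambda>x. f x * ?w x)"
    if "bounded (range f)" "f \<in> borel_measurable ?M" for f :: "(nat \<Rightarrow> real) \<Rightarrow> real"
  proof -
    have "bounded (range (\<lambda>x. complex_of_real (f x)))"
      using that(1) by (simp add: bounded_iff)
    from integrable_bounded_mult_hermite_weight[OF assms(1) this] that(2)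
    have "integrable ?M (\<lambda>x. complex_of_real (f x) * complex_of_real (?w x))" by simp
    from integrable_Re[OF this] show ?thesis by simp
  qed
  have h_int: "integrable ?M (\<lambda>x. h x * ?w x)"
  proof (rule real_int)
    have "bounded (range (\<lambda>x. complex_of_real C * (S x * cnj (S x) + of_real ((norm z)\<^sup>2))))"
      using S_bdd by (intro bounded_range_mult bounded_range_add bounded_range_const) (auto simp: bounded_iff)
    moreover have "complex_of_real (h x) = complex_of_real C * (S x * cnj (S x) + of_real ((norm z)\<^sup>2))" for x
      by (simp add: h_def flip: complex_norm_square)
    ultimately have "bounded (range (\<lambda>x. complex_of_real (h x)))" by simp
    then show "bounded (range h)" by (simp add: bounded_iff)
    show "h \<in> borel_measurable ?M" unfolding h_def by measurable
  qed
  have Q_int: "integrable ?M (\<lambda>x. (norm (Q x))\<^sup>2 * ?w x)"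
  proof (rule real_int)
    have "bounded (range (\<lambda>x. Q x * Q x))" by (intro bounded_range_mult Q_bdd)
    then show "bounded (range (\<lambda>x. (norm (Q x))\<^sup>2))" by (simp add: bounded_iff norm_mult power2_eq_square)
  qed measurable
  have F_int: "integrable ?M (\<lambda>x. F x * of_real (?w x))"
  proof (rule integrable_bounded_mult_hermite_weight[OF assms(1)])
    note [measurable] = coordinate_measurable G'_measurable
    show "F \<in> borel_measurable ?M"
      using G_measurable unfolding F_def by measurable
    show "bounded (range F)"
      unfolding F_def power2_eq_square
      by (intro bounded_range_diff bounded_range_add bounded_range_mult bounded_range_sum bounded_resolvent
            G_bounded G'_bounded bounded_range_const Q_bdd assms)
  qed
  have "0 = Re (LINT x|?M. F x * of_real (?w x))" unfolding zero by simp
  also have "\<dots> = (LINT x|?M. Re (F x) * ?w x)"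
    using integral_Re[OF F_int] by simp
  also have "\<dots> \<le> (LINT x|?M. \<beta> / 4 * (h x * ?w x - (norm (Q x))\<^sup>2 * ?w x))"
  proof (rule integral_mono)
    show "integrable ?M (\<lambda>x. Re (F x) * ?w x)"
      using integrable_Re[OF F_int] by simp
    show "integrable ?M (\<lambda>x. \<beta> / 4 * (h x * ?w x - (norm (Q x))\<^sup>2 * ?w x))"
      by (intro integrable_mult_right Bochner_Integration.integrable_diff h_int Q_int)
    show "Re (F x) * ?w x \<le> \<beta> / 4 * (h x * ?w x - (norm (Q x))\<^sup>2 * ?w x)" for x
      using mult_right_mono[OF Re_F[of x] hermite_weight_nonneg[OF assms(1), of n x]]
      by (simp add: algebra_simps)
  qed
  also have "\<dots> = \<beta> / 4 * ((LINT x|?M. h x * ?w x) - (LINT x|?M. (norm (Q x))\<^sup>2 * ?w x))"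
    by (simp only: integral_mult_right_zero Bochner_Integration.integral_diff[OF h_int Q_int])
  finally have "(LINT x|?M. (norm (Q x))\<^sup>2 * ?w x) \<le> (LINT x|?M. h x * ?w x)"
    using assms(1) by (simp only: zero_le_mult_iff) simp
  then show ?thesis by (simp add: Q_def h_def S_def C_def \<eta>_def mult.assoc)
qed

lemma hermite_ensemble_measurable:
  assumes "hermite_ensemble \<beta> n M \<Lambda>" "k \<in> {1..n}"
  shows "\<Lambda> k \<in> borel_measurable M"
proof -
  have X: "(\<lambda>\<omega>. \<lambda>i\<in>{1..n}. \<Lambda> i \<omega>) \<in> measurable M (\<Pi>\<^sub>M i\<in>{1..n}. lborel)"
    using assms(1) by (auto simp: hermite_ensemble_def distributed_def)
  have "(\<lambda>\<omega>. (\<lambda>i\<in>{1..n}. \<Lambda> i \<omega>) k) \<in> measurable M lborel"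
    by (rule measurable_compose[OF X measurable_component_singleton[OF assms(2)]])
  then show ?thesis using assms(2) by simp
qed

lemma hermite_ensemble_expectation:
  fixes g :: "(nat \<Rightarrow> real) \<Rightarrow> real"
  assumes "\<beta> > 0" "hermite_ensemble \<beta> n M \<Lambda>" "g \<in> borel_measurable (\<Pi>\<^sub>M i\<in>{1..n}. lborel)"
  shows "(\<integral>\<omega>. g (\<lambda>i\<in>{1..n}. \<Lambda> i \<omega>) \<partial>M)
    = 1 / hermite_Z \<beta> n * (LINT x|(\<Pi>\<^sub>M i\<in>{1..n}. lborel). g x * hermite_weight \<beta> n x)"
proof -
  have "hermite_Z \<beta> n \<ge> 0"
    unfolding hermite_Z_def by (intro integral_nonneg_AE AE_I2 hermite_weight_nonneg assms)
  then have nonneg: "hermite_density \<beta> n x \<ge> 0" for x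
    unfolding hermite_density_def using hermite_weight_nonneg[OF assms(1)] by simp
  have dist: "distributed M (\<Pi>\<^sub>M i\<in>{1..n}. lborel) (\<lambda>\<omega>. \<lambda>i\<in>{1..n}. \<Lambda> i \<omega>) (\<lambda>x. ennreal (hermite_density \<beta> n x))"
    using assms(2) by (simp only: hermite_ensemble_def)
  have "(\<integral>\<omega>. g (\<lambda>i\<in>{1..n}. \<Lambda> i \<omega>) \<partial>M)
      = (LINT x|(\<Pi>\<^sub>M i\<in>{1..n}. lborel). hermite_density \<beta> n x * g x)"
    by (rule distributed_integral[OF dist assms(3) nonneg, symmetric])
  also have "\<dots> = (LINT x|(\<Pi>\<^sub>M i\<in>{1..n}. lborel). 1 / hermite_Z \<beta> n * (g x * hermite_weight \<beta> n x))"
    by (simp add: hermite_density_def mult_ac)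
  also have "\<dots> = 1 / hermite_Z \<beta> n * (LINT x|(\<Pi>\<^sub>M i\<in>{1..n}. lborel). g x * hermite_weight \<beta> n x)"
    by (rule integral_mult_right_zero)
  finally show ?thesis .
qed

lemma stieltjes_sum_restrict [simp]:
  "stieltjes_sum n z (\<lambda>i\<in>{1..n}. x i) = stieltjes_sum n z x"
  "loop_defect n z (\<lambda>i\<in>{1..n}. x i) = loop_defect n z x"
  by (auto simp: stieltjes_sum_def loop_defect_def intro!: sum.cong)

lemma stieltjes_sum_random_variable:
  assumes "hermite_ensemble \<beta> n M \<Lambda>"
  shows "(\<lambda>\<omega>. stieltjes_sum n z (\<lambda>i. \<Lambda> i \<omega>)) \<in> borel_measurable M"
proof -
  note [measurable] = hermite_ensemble_measurable[OF assms]
  show ?thesis unfolding stieltjes_sum_def by measurable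
qed

lemma expected_loop_defect_bound:
  assumes "\<beta> > 0" "hermite_ensemble \<beta> n M \<Lambda>" "Im z > 0"
  shows "(\<integral>\<omega>. (norm (loop_defect n z (\<lambda>i. \<Lambda> i \<omega>)))\<^sup>2 \<partial>M)
    \<le> loop_const \<beta> / (Im z)\<^sup>2 * (\<integral>\<omega>. (norm (stieltjes_sum n z (\<lambda>i. \<Lambda> i \<omega>)))\<^sup>2 + (norm z)\<^sup>2 \<partial>M)"
proof -
  have Z: "1 / hermite_Z \<beta> n \<ge> 0"
    unfolding hermite_Z_def zero_le_divide_1_iff by (intro integral_nonneg_AE AE_I2 hermite_weight_nonneg assms)
  have "(\<integral>\<omega>. (norm (loop_defect n z (\<lambda>i\<in>{1..n}. \<Lambda> i \<omega>)))\<^sup>2 \<partial>M)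
      \<le> (\<integral>\<omega>. loop_const \<beta> / (Im z)\<^sup>2 * ((norm (stieltjes_sum n z (\<lambda>i\<in>{1..n}. \<Lambda> i \<omega>)))\<^sup>2 + (norm z)\<^sup>2) \<partial>M)"
    by (subst (1 2) hermite_ensemble_expectation[OF assms(1,2)])
       (measurable, intro mult_left_mono weighted_loop_defect_bound assms Z)
  then show ?thesis unfolding stieltjes_sum_restrict by simp
qed

section \<open>Concentration of the Stieltjes transform in the bulk\<close>

text \<open>The Stieltjes transform of the empirical measure of the points \<open>x i / sqrt n\<close>.\<close>

definition emp_stieltjes :: "nat \<Rightarrow> complex \<Rightarrow> (nat \<Rightarrow> real) \<Rightarrow> complex" where
  "emp_stieltjes n w x = stieltjes_sum n (of_real (sqrt n) * w) x / of_real (sqrt n)"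

text \<open>The boundary value \<open>m(x + i0)\<close> of the Stieltjes transform of the semicircle law; its imaginary part
  is \<open>pi * rho_sc x\<close>.\<close>

definition sc_boundary :: "real \<Rightarrow> complex" where
  "sc_boundary x = Complex (- x / 2) (sqrt (4 - x\<^sup>2) / 2)"

lemma sc_boundary:
  assumes "- 2 < x" "x < 2"
  shows "Im (sc_boundary x) > 0" "norm (sc_boundary x) = 1"
    "(s - sc_boundary x) * (s - cnj (sc_boundary x)) = s\<^sup>2 + of_real x * s + 1"
proof -
  have pos: "4 - x\<^sup>2 > 0"
  proof -
    have "0 < (2 - x) * (2 + x)" using assms by simp
    then show ?thesis by (simp add: power2_eq_square algebra_simps)
  qed
  then show "Im (sc_boundary x) > 0" by (simp add: sc_boundary_def)
  have norm: "(norm (sc_boundary x))\<^sup>2 = 1"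
    using pos by (simp add: sc_boundary_def cmod_power2 power_divide field_simps)
  then show "norm (sc_boundary x) = 1"
    by (metis norm_ge_zero one_power2 power2_eq_imp_eq zero_le_one)
  have "sc_boundary x * cnj (sc_boundary x) = 1"
    using norm complex_norm_square[of "sc_boundary x"] by simp
  moreover have "sc_boundary x + cnj (sc_boundary x) = - of_real x"
    by (simp add: complex_eq_iff sc_boundary_def)
  moreover have "(s - m) * (s - m') = s\<^sup>2 - (m + m') * s + m * m'" for m m' :: complex
    by (simp add: power2_eq_square algebra_simps)
  ultimately show "(s - sc_boundary x) * (s - cnj (sc_boundary x)) = s\<^sup>2 + of_real x * s + 1"
    by simp
qed

lemma Im_emp_stieltjes_nonneg:
  assumes "Im w > 0" "n \<ge> 1"
  shows "Im (emp_stieltjes n w x) \<ge> 0"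
proof -
  have "Im (of_real (sqrt n) * w) > 0" using assms by simp
  then have "Im (stieltjes_sum n (of_real (sqrt n) * w) x) \<ge> 0"
    unfolding stieltjes_sum_def by (auto simp: Im_resolvent intro!: sum_nonneg)
  then show ?thesis by (simp add: emp_stieltjes_def Im_divide_of_real)
qed

lemma power2_sum_le: "(a + b)\<^sup>2 \<le> 2 * a\<^sup>2 + 2 * (b::real)\<^sup>2"
proof -
  have "0 \<le> (a - b)\<^sup>2" by simp
  then show ?thesis by (simp add: power2_eq_square algebra_simps)
qed

text \<open>The loop defect divided by \<open>n\<close> is \<open>s\<^sup>2 + w s + 1\<close>; replacing \<open>w\<close> by \<open>x\<close> costs \<open>\<bar>w - x\<bar> \<bar>s\<bar>\<close>, and
  \<open>s\<^sup>2 + x s + 1 = (s - m) (s - cnj m)\<close>. Since \<open>Im s \<ge> 0\<close>, the factor \<open>s - cnj m\<close> is at least \<open>Im m\<close> in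
  modulus whatever the configuration, so no a priori closeness of \<open>s\<close> to \<open>m\<close> is needed to invert the
  quadratic equation.\<close>

lemma emp_stieltjes_stability:
  assumes "- 2 < x" "x < 2" "n \<ge> 1" "Im w > 0"
  shows "(Im (sc_boundary x))\<^sup>2 * (norm (emp_stieltjes n w y - sc_boundary x))\<^sup>2
    \<le> 2 * ((norm (loop_defect n (of_real (sqrt n) * w) y))\<^sup>2 / n\<^sup>2)
       + 2 * (norm (w - of_real x))\<^sup>2 * (norm (emp_stieltjes n w y))\<^sup>2"
proof -
  let ?s = "emp_stieltjes n w y" and ?m = "sc_boundary x" and ?z = "of_real (sqrt n) * w"
  have r: "of_real (sqrt n) * of_real (sqrt n) = (of_nat n :: complex)"
    by (simp flip: of_real_mult)
  have S: "stieltjes_sum n ?z y = of_real (sqrt n) * ?s"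
    using assms(3) by (simp add: emp_stieltjes_def)
  have "loop_defect n ?z y = of_real (sqrt n) * of_real (sqrt n) * ?s\<^sup>2 + of_real (sqrt n) * of_real (sqrt n) * (w * ?s) + of_nat n"
    unfolding loop_defect_def S by (simp add: power2_eq_square mult_ac)
  then have Q: "loop_defect n ?z y = of_nat n * (?s\<^sup>2 + w * ?s + 1)"
    unfolding r by (simp add: algebra_simps)
  have "Im ?m \<le> Im ?s + Im ?m" using Im_emp_stieltjes_nonneg assms by simp
  also have "\<dots> = Im (?s - cnj ?m)" by simp
  also have "\<dots> \<le> norm (?s - cnj ?m)" using abs_Im_le_cmod abs_ge_self order_trans by blast
  finally have "Im ?m * norm (?s - ?m) \<le> norm (?s - cnj ?m) * norm (?s - ?m)"
    by (rule mult_right_mono) simp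
  also have "\<dots> = norm ((?s\<^sup>2 + w * ?s + 1) + (of_real x - w) * ?s)"
    unfolding norm_mult[symmetric] mult.commute[of "?s - cnj ?m"] sc_boundary(3)[OF assms(1,2)]
    by (simp add: algebra_simps)
  also have "\<dots> \<le> norm (?s\<^sup>2 + w * ?s + 1) + norm (w - of_real x) * norm ?s"
    by (metis norm_triangle_ineq norm_mult norm_minus_commute)
  finally have "(Im ?m * norm (?s - ?m))\<^sup>2 \<le> (norm (?s\<^sup>2 + w * ?s + 1) + norm (w - of_real x) * norm ?s)\<^sup>2"
    using sc_boundary(1)[OF assms(1,2)] by (intro power_mono) auto
  also have "\<dots> \<le> 2 * (norm (?s\<^sup>2 + w * ?s + 1))\<^sup>2 + 2 * (norm (w - of_real x) * norm ?s)\<^sup>2"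
    by (rule power2_sum_le)
  also have "norm (?s\<^sup>2 + w * ?s + 1) = norm (loop_defect n ?z y) / n"
    unfolding Q using assms(3) by (simp add: norm_mult)
  finally show ?thesis by (simp add: power_mult_distrib power_divide)
qed

text \<open>Write \<open>e\<close> for the left-hand side and \<open>\<tau>\<close> for the sum of squares on the right. Taking expectations in
  the stability estimate and inserting the second-moment bound for the loop defect gives
  \<open>c\<^sup>2 e \<le> 4 K \<tau> e + 22 K \<tau>\<close> with \<open>c = Im (sc_boundary x)\<close>. For small \<open>\<tau>\<close> the first term on the right
  is absorbed by the left-hand side.\<close>

lemma emp_stieltjes_L2:
  assumes "\<beta> > 0" "- 2 < x" "x < 2"
  obtains C \<tau>\<^sub>0 :: real where "C > 0" "\<tau>\<^sub>0 > 0"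
    "\<And>n (M :: 'a measure) \<Lambda> w. n \<ge> 1 \<Longrightarrow> hermite_ensemble \<beta> n M \<Lambda> \<Longrightarrow> Im w > 0 \<Longrightarrow>
       1 / (n * Im w)\<^sup>2 + (norm (w - of_real x))\<^sup>2 \<le> \<tau>\<^sub>0 \<Longrightarrow>
       (\<integral>\<omega>. (norm (emp_stieltjes n w (\<lambda>i. \<Lambda> i \<omega>) - sc_boundary x))\<^sup>2 \<partial>M)
         \<le> C * (1 / (n * Im w)\<^sup>2 + (norm (w - of_real x))\<^sup>2)"
proof
  define c where "c = Im (sc_boundary x)"
  define K where "K = max (loop_const \<beta>) 1"
  have c: "c > 0" using sc_boundary assms by (simp add: c_def)
  have K: "K \<ge> 1" "loop_const \<beta> \<le> K" by (auto simp: K_def)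
  show "44 * K / c\<^sup>2 > 0" using K c by simp
  show "min 1 (c\<^sup>2 / (8 * K)) > 0" using K c by simp
  fix n :: nat and M :: "'a measure" and \<Lambda> w
  assume n: "n \<ge> 1" and ens: "hermite_ensemble \<beta> n M \<Lambda>" and w: "Im w > 0"
    and small: "1 / (n * Im w)\<^sup>2 + (norm (w - of_real x))\<^sup>2 \<le> min 1 (c\<^sup>2 / (8 * K))"
  define \<tau> where "\<tau> = 1 / (n * Im w)\<^sup>2 + (norm (w - of_real x))\<^sup>2"
  define z where "z = of_real (sqrt n) * w"
  have z: "Im z > 0" using w n by (simp add: z_def)
  interpret prob_space M using ens by (simp add: hermite_ensemble_def)
  let ?Y = "\<lambda>\<omega> i. \<Lambda> i \<omega>"
  let ?s = "\<lambda>\<omega>. emp_stieltjes n w (?Y \<omega>)"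
  have [measurable]: "(\<lambda>\<omega>. stieltjes_sum n z (?Y \<omega>)) \<in> borel_measurable M"
    by (rule stieltjes_sum_random_variable[OF ens])
  have s_meas [measurable]: "?s \<in> borel_measurable M"
    unfolding emp_stieltjes_def z_def[symmetric] by measurable
  have Q_meas [measurable]: "(\<lambda>\<omega>. loop_defect n z (?Y \<omega>)) \<in> borel_measurable M"
    unfolding loop_defect_def by measurable
  have s_le: "norm (?s \<omega>) \<le> n / Im z / sqrt n" for \<omega>
    unfolding emp_stieltjes_def z_def[symmetric] norm_divide
    using divide_right_mono[OF norm_stieltjes_sum_le[OF z, of n "?Y \<omega>"], of "sqrt n"] by simp
  have bounded_int: "integrable M (\<lambda>\<omega>. (norm (f \<omega>))\<^sup>2)"
    if "f \<in> borel_measurable M" "\<And>\<omega>. norm (f \<omega>) \<le> B" for f :: "'a \<Rightarrow> complex" and B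
    using that by (intro integrable_const_bound[of _ "B\<^sup>2"]) (auto intro!: power_mono)
  have s_int: "integrable M (\<lambda>\<omega>. (norm (?s \<omega>))\<^sup>2)"
    by (rule bounded_int[OF s_meas s_le])
  have e_int: "integrable M (\<lambda>\<omega>. (norm (?s \<omega> - sc_boundary x))\<^sup>2)"
  proof (rule bounded_int)
    show "norm (?s \<omega> - sc_boundary x) \<le> n / Im z / sqrt n + 1" for \<omega>
      using norm_triangle_ineq4[of "?s \<omega>" "sc_boundary x"] s_le[of \<omega>] sc_boundary(2)[OF assms(2,3)] by linarith
  qed measurable
  obtain B where B: "\<And>y. norm (loop_defect n z y) \<le> B"
    using bounded_loop_defect[OF z] by (auto simp: bounded_range_iff)
  have Q_int: "integrable M (\<lambda>\<omega>. (norm (loop_defect n z (?Y \<omega>)))\<^sup>2)"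
    by (rule bounded_int[OF Q_meas B])
  define e where "e = (\<integral>\<omega>. (norm (?s \<omega> - sc_boundary x))\<^sup>2 \<partial>M)"
  define es where "es = (\<integral>\<omega>. (norm (?s \<omega>))\<^sup>2 \<partial>M)"
  define q where "q = (\<integral>\<omega>. (norm (loop_defect n z (?Y \<omega>)))\<^sup>2 \<partial>M)"
  have "e \<ge> 0" "es \<ge> 0" unfolding e_def es_def by (auto intro!: integral_nonneg_AE)
  have es_le: "es \<le> 2 * e + 2"
  proof -
    have "(norm (?s \<omega>))\<^sup>2 \<le> 2 * (norm (?s \<omega> - sc_boundary x))\<^sup>2 + 2" for \<omega>
    proof -
      have "norm (?s \<omega>) \<le> norm (?s \<omega> - sc_boundary x) + 1"
        using norm_triangle_ineq[of "?s \<omega> - sc_boundary x" "sc_boundary x"] sc_boundary(2)[OF assms(2,3)] by simp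
      then have "(norm (?s \<omega>))\<^sup>2 \<le> (norm (?s \<omega> - sc_boundary x) + 1)\<^sup>2" by (intro power_mono) auto
      also have "\<dots> \<le> 2 * (norm (?s \<omega> - sc_boundary x))\<^sup>2 + 2 * 1\<^sup>2" by (rule power2_sum_le)
      finally show ?thesis by simp
    qed
    then have "es \<le> (\<integral>\<omega>. 2 * (norm (?s \<omega> - sc_boundary x))\<^sup>2 + 2 \<partial>M)"
      unfolding es_def using s_int e_int by (intro integral_mono) auto
    also have "\<dots> = 2 * e + 2"
      unfolding e_def using e_int by (simp add: prob_space)
    finally show ?thesis .
  qed
  have "norm w \<le> 3"
  proof -
    have "(norm (w - of_real x))\<^sup>2 \<le> 1\<^sup>2"
    proof -
      have "0 \<le> 1 / (n * Im w)\<^sup>2" by simp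
      moreover have "1 / (n * Im w)\<^sup>2 + (norm (w - of_real x))\<^sup>2 \<le> 1" using small by simp
      ultimately show ?thesis unfolding one_power2 by linarith
    qed
    then have "norm (w - of_real x) \<le> 1" by (rule power2_le_imp_le) simp
    moreover have "norm (complex_of_real x) \<le> 2" using assms by simp
    ultimately show ?thesis using norm_triangle_ineq[of "w - of_real x" "of_real x"] by simp
  qed
  then have w9: "(norm w)\<^sup>2 \<le> 9" using power_mono[of "norm w" 3 2] by simp
  have "q \<le> loop_const \<beta> / (Im z)\<^sup>2 * (\<integral>\<omega>. (norm (stieltjes_sum n z (?Y \<omega>)))\<^sup>2 + (norm z)\<^sup>2 \<partial>M)"
    unfolding q_def by (rule expected_loop_defect_bound[OF assms(1) ens z])
  also have "\<dots> = loop_const \<beta> / (Im z)\<^sup>2 * (\<integral>\<omega>. n * (norm (?s \<omega>))\<^sup>2 + n * (norm w)\<^sup>2 \<partial>M)"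
  proof -
    have "stieltjes_sum n z (?Y \<omega>) = of_real (sqrt n) * ?s \<omega>" for \<omega>
      using n by (simp add: emp_stieltjes_def z_def)
    then show ?thesis by (simp add: z_def norm_mult power_mult_distrib)
  qed
  also have "(\<integral>\<omega>. n * (norm (?s \<omega>))\<^sup>2 + n * (norm w)\<^sup>2 \<partial>M) = n * (es + (norm w)\<^sup>2)"
    unfolding es_def using s_int by (simp add: prob_space algebra_simps)
  also have "loop_const \<beta> / (Im z)\<^sup>2 * (n * (es + (norm w)\<^sup>2)) = loop_const \<beta> / (Im w)\<^sup>2 * (es + (norm w)\<^sup>2)"
    using n by (simp add: z_def power_mult_distrib)
  also have "\<dots> \<le> K / (Im w)\<^sup>2 * (es + 9)"
    using K w9 \<open>es \<ge> 0\<close> by (intro mult_mono divide_right_mono) auto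
  finally have "q \<le> K / (Im w)\<^sup>2 * (es + 9)" .
  from divide_right_mono[OF this, of "(real n)\<^sup>2"]
  have q_le: "q / n\<^sup>2 \<le> K * (1 / (n * Im w)\<^sup>2) * (es + 9)"
    by (simp add: power_mult_distrib mult_ac)
  have "c\<^sup>2 * e = (\<integral>\<omega>. c\<^sup>2 * (norm (?s \<omega> - sc_boundary x))\<^sup>2 \<partial>M)"
    unfolding e_def by simp
  also have "\<dots> \<le> (\<integral>\<omega>. 2 * ((norm (loop_defect n z (?Y \<omega>)))\<^sup>2 / n\<^sup>2)
       + 2 * (norm (w - of_real x))\<^sup>2 * (norm (?s \<omega>))\<^sup>2 \<partial>M)"
    unfolding c_def z_def
    using e_int Q_int s_int emp_stieltjes_stability[OF assms(2,3) n w]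
    by (intro integral_mono) (auto simp: z_def)
  also have "\<dots> = 2 * (q / n\<^sup>2) + 2 * (norm (w - of_real x))\<^sup>2 * es"
    unfolding q_def es_def using Q_int s_int by simp
  also have "\<dots> \<le> 2 * (K * (1 / (n * Im w)\<^sup>2) * (es + 9)) + 2 * (K * (norm (w - of_real x))\<^sup>2) * (es + 9)"
    using q_le \<open>es \<ge> 0\<close> K by (intro add_mono mult_left_mono mult_mono) (auto simp: mult_le_cancel_right1)
  also have "\<dots> = 2 * K * \<tau> * (es + 9)"
    unfolding \<tau>_def by (simp add: algebra_simps)
  also have "\<dots> \<le> 2 * K * \<tau> * (2 * e + 11)"
    using es_le K by (intro mult_left_mono) (auto simp: \<tau>_def)
  also have "\<dots> = 4 * K * \<tau> * e + 22 * K * \<tau>"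
    by (simp add: algebra_simps)
  also have "4 * K * \<tau> * e \<le> c\<^sup>2 / 2 * e"
  proof (rule mult_right_mono[OF _ \<open>e \<ge> 0\<close>])
    have "\<tau> \<le> c\<^sup>2 / (8 * K)" using small by (simp add: \<tau>_def)
    then show "4 * K * \<tau> \<le> c\<^sup>2 / 2" using K by (simp add: field_simps)
  qed
  finally have "c\<^sup>2 * e \<le> 44 * K * \<tau>" by simp
  then have "e \<le> 44 * K / c\<^sup>2 * \<tau>" using c by (simp add: field_simps)
  then show "(\<integral>\<omega>. (norm (?s \<omega> - sc_boundary x))\<^sup>2 \<partial>M)
         \<le> 44 * K / c\<^sup>2 * (1 / (n * Im w)\<^sup>2 + (norm (w - of_real x))\<^sup>2)"
    unfolding e_def \<tau>_def .
qed

lemma emp_stieltjes_bounded: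
  assumes "Im w > 0" "n \<ge> 1"
  shows "norm (emp_stieltjes n w y) \<le> 1 / Im w"
proof -
  let ?z = "of_real (sqrt n) * w"
  have "Im ?z > 0" using assms by simp
  from divide_right_mono[OF norm_stieltjes_sum_le[OF this, of n y], of "sqrt n"]
  have "norm (emp_stieltjes n w y) \<le> n / (sqrt n * Im w) / sqrt n"
    unfolding emp_stieltjes_def norm_divide by simp
  also have "\<dots> = n / (sqrt n * sqrt n) / Im w"
    by (simp only: divide_divide_eq_left mult_ac)
  also have "\<dots> = 1 / Im w" using assms(2) by simp
  finally show ?thesis .
qed

lemma emp_stieltjes_random_variable:
  assumes "hermite_ensemble \<beta> n M \<Lambda>"
  shows "(\<lambda>\<omega>. emp_stieltjes n w (\<lambda>i. \<Lambda> i \<omega>)) \<in> borel_measurable M"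
proof -
  note [measurable] = stieltjes_sum_random_variable[OF assms]
  show ?thesis unfolding emp_stieltjes_def by measurable
qed

lemma emp_stieltjes_integrable:
  assumes "hermite_ensemble \<beta> n M \<Lambda>" "n \<ge> 1" "Im w > 0"
  shows "integrable M (\<lambda>\<omega>. emp_stieltjes n w (\<lambda>i. \<Lambda> i \<omega>))"
proof -
  interpret prob_space M using assms(1) by (simp add: hermite_ensemble_def)
  show ?thesis
    using emp_stieltjes_bounded[OF assms(3,2)] emp_stieltjes_random_variable[OF assms(1)]
    by (intro integrable_const_bound[of _ "1 / Im w"]) auto
qed

text \<open>From the \<open>L\<^sup>2\<close> bound by \<open>d \<le> \<theta>/2 + d\<^sup>2/(2 \<theta>)\<close>.\<close>

lemma emp_stieltjes_L1:
  assumes "\<beta> > 0" "- 2 < x" "x < 2" "\<theta> > 0"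
  obtains \<tau> :: real where "\<tau> > 0"
    "\<And>n (M :: 'a measure) \<Lambda> w. n \<ge> 1 \<Longrightarrow> hermite_ensemble \<beta> n M \<Lambda> \<Longrightarrow> Im w > 0 \<Longrightarrow>
       1 / (n * Im w)\<^sup>2 + (norm (w - of_real x))\<^sup>2 \<le> \<tau> \<Longrightarrow>
       (\<integral>\<omega>. norm (emp_stieltjes n w (\<lambda>i. \<Lambda> i \<omega>) - sc_boundary x) \<partial>M) \<le> \<theta>"
proof -
  obtain C \<tau>\<^sub>0 where C: "C > 0" "\<tau>\<^sub>0 > 0"
    "\<And>n (M :: 'a measure) \<Lambda> w. n \<ge> 1 \<Longrightarrow> hermite_ensemble \<beta> n M \<Lambda> \<Longrightarrow> Im w > 0 \<Longrightarrow>
       1 / (n * Im w)\<^sup>2 + (norm (w - of_real x))\<^sup>2 \<le> \<tau>\<^sub>0 \<Longrightarrow>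
       (\<integral>\<omega>. (norm (emp_stieltjes n w (\<lambda>i. \<Lambda> i \<omega>) - sc_boundary x))\<^sup>2 \<partial>M)
         \<le> C * (1 / (n * Im w)\<^sup>2 + (norm (w - of_real x))\<^sup>2)"
    by (rule emp_stieltjes_L2[OF assms(1-3)]) (rule that)
  show thesis
  proof
    show "min \<tau>\<^sub>0 (\<theta>\<^sup>2 / C) > 0" using C assms(4) by simp
    fix n :: nat and M :: "'a measure" and \<Lambda> w
    assume n: "n \<ge> 1" and ens: "hermite_ensemble \<beta> n M \<Lambda>" and w: "Im w > 0"
      and small: "1 / (n * Im w)\<^sup>2 + (norm (w - of_real x))\<^sup>2 \<le> min \<tau>\<^sub>0 (\<theta>\<^sup>2 / C)"
    interpret prob_space M using ens by (simp add: hermite_ensemble_def)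
    let ?d = "\<lambda>\<omega>. norm (emp_stieltjes n w (\<lambda>i. \<Lambda> i \<omega>) - sc_boundary x)"
    have int: "integrable M ?d"
      by (intro integrable_norm Bochner_Integration.integrable_diff emp_stieltjes_integrable[OF ens n w]) simp
    have sq_int: "integrable M (\<lambda>\<omega>. (?d \<omega>)\<^sup>2)"
    proof (rule integrable_const_bound[of _ "(1 / Im w + 1)\<^sup>2"])
      have "?d \<omega> \<le> 1 / Im w + 1" for \<omega>
        using norm_triangle_ineq4[of "emp_stieltjes n w (\<lambda>i. \<Lambda> i \<omega>)" "sc_boundary x"]
          emp_stieltjes_bounded[OF w n, of "\<lambda>i. \<Lambda> i \<omega>"] sc_boundary(2)[OF assms(2,3)] by linarith
      then show "AE \<omega> in M. norm ((?d \<omega>)\<^sup>2) \<le> (1 / Im w + 1)\<^sup>2"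
        by (auto intro!: power_mono)
      show "(\<lambda>\<omega>. (?d \<omega>)\<^sup>2) \<in> borel_measurable M"
        using borel_measurable_integrable[OF int] by measurable
    qed
    have "?d \<omega> \<le> \<theta> / 2 + (?d \<omega>)\<^sup>2 / (2 * \<theta>)" for \<omega>
    proof -
      have "0 \<le> (?d \<omega> - \<theta>)\<^sup>2 / (2 * \<theta>)" using assms(4) by simp
      also have "\<dots> = \<theta> / 2 + (?d \<omega>)\<^sup>2 / (2 * \<theta>) - ?d \<omega>"
        using assms(4) by (simp add: power2_eq_square field_simps)
      finally show ?thesis by simp
    qed
    then have "(\<integral>\<omega>. ?d \<omega> \<partial>M) \<le> (\<integral>\<omega>. \<theta> / 2 + (?d \<omega>)\<^sup>2 / (2 * \<theta>) \<partial>M)"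
      using int sq_int by (intro integral_mono) auto
    also have "\<dots> = \<theta> / 2 + (\<integral>\<omega>. (?d \<omega>)\<^sup>2 \<partial>M) / (2 * \<theta>)"
      using sq_int by (simp add: prob_space)
    also have "\<dots> \<le> \<theta> / 2 + \<theta>\<^sup>2 / (2 * \<theta>)"
    proof -
      have "(\<integral>\<omega>. (?d \<omega>)\<^sup>2 \<partial>M) \<le> C * (1 / (n * Im w)\<^sup>2 + (norm (w - of_real x))\<^sup>2)"
        using small by (intro C(3) n ens w) simp
      also have "\<dots> \<le> C * (\<theta>\<^sup>2 / C)"
        using C(1) small by (intro mult_left_mono) auto
      finally show ?thesis
        using C(1) assms(4) by (intro add_left_mono divide_right_mono) auto
    qed
    also have "\<dots> = \<theta>"
      using assms(4) by (simp add: power2_eq_square)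
    finally show "(\<integral>\<omega>. ?d \<omega> \<partial>M) \<le> \<theta>" .
  qed
qed

section \<open>Poisson smoothing of an interval\<close>

text \<open>The Poisson kernel of the upper half plane, up to the factor \<open>1/pi\<close>.\<close>

definition poisson :: "complex \<Rightarrow> real \<Rightarrow> real" where
  "poisson \<zeta> y = Im (resolvent \<zeta> y)"

lemma poisson_eq: "poisson \<zeta> y = Im \<zeta> / ((y - Re \<zeta>)\<^sup>2 + (Im \<zeta>)\<^sup>2)"
  by (simp add: poisson_def resolvent_def Im_divide)

lemma poisson_nonneg: "Im \<zeta> \<ge> 0 \<Longrightarrow> poisson \<zeta> y \<ge> 0"
  by (simp add: poisson_eq)

lemma arctan_diff_bounds:
  fixes a b :: real
  assumes "0 < a" "a \<le> b"
  shows "arctan b - arctan a \<le> 1 / a" "arctan b - arctan a \<le> (b - a) / a\<^sup>2"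
proof -
  have "arctan b - arctan a \<le> pi / 2 - arctan a"
    using arctan_ubound[of b] by simp
  also have "\<dots> = arctan (1 / a)"
    using arctan_inverse[of a] assms by (simp add: inverse_eq_divide)
  also have "\<dots> \<le> 1 / a"
    using assms by (intro arctan_le_self) simp
  finally show "arctan b - arctan a \<le> 1 / a" .
  show "arctan b - arctan a \<le> (b - a) / a\<^sup>2"
  proof (cases "a = b")
    case False
    then obtain z where z: "a < z" "arctan b - arctan a = (b - a) * inverse (1 + z\<^sup>2)"
      using MVT2[of a b arctan "\<lambda>z. inverse (1 + z\<^sup>2)"] DERIV_arctan assms by auto
    have "a\<^sup>2 \<le> 1 + z\<^sup>2"
      using power_mono[of a z 2] z(1) assms(1) by linarith
    then have "inverse (1 + z\<^sup>2) \<le> inverse (a\<^sup>2)"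
      using assms by (intro le_imp_inverse_le) auto
    then show ?thesis
      unfolding z(2) divide_inverse using assms by (intro mult_left_mono) auto
  qed simp
qed

text \<open>The indicator function of the unit interval convolved with the normalised Poisson kernel at height \<open>\<eta>\<close>,
  see \<open>poisson_integral_unit_interval\<close> below.\<close>

definition smoothed_unit_interval :: "real \<Rightarrow> real \<Rightarrow> real" where
  "smoothed_unit_interval \<eta> y = (arctan ((1 - y) / \<eta>) + arctan (y / \<eta>)) / pi"

lemma smoothed_unit_interval_bounds:
  assumes "\<eta> > 0"
  shows "0 \<le> smoothed_unit_interval \<eta> y" "smoothed_unit_interval \<eta> y \<le> 1"
proof -
  have "arctan (- (y / \<eta>)) \<le> arctan ((1 - y) / \<eta>)"
    using assms by (simp add: arctan_le_iff field_simps)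
  then show "0 \<le> smoothed_unit_interval \<eta> y"
    by (simp add: smoothed_unit_interval_def arctan_minus)
  show "smoothed_unit_interval \<eta> y \<le> 1"
    using arctan_ubound[of "(1 - y) / \<eta>"] arctan_ubound[of "y / \<eta>"]
    by (simp add: smoothed_unit_interval_def)
qed

text \<open>With \<open>\<eta> = \<kappa>\<^sup>2\<close>, the smoothed indicator at distance \<open>v\<close> outside the interval is at most both \<open>\<eta>/v\<close> and
  \<open>\<eta>/v\<^sup>2\<close>. The first bound is used up to distance \<open>1\<close>, where it gives \<open>\<kappa>\<close> because \<open>v \<ge> \<kappa>\<close>; the second
  has the decay of a Poisson kernel.\<close>

lemma smoothed_unit_interval_outside:
  assumes "0 < \<kappa>" "\<kappa> \<le> 1" "v \<ge> \<kappa>"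
  shows "smoothed_unit_interval (\<kappa>\<^sup>2) (1 + v) \<le> 5 * \<kappa> / (1 + (1 + v)\<^sup>2)"
proof -
  have v: "v > 0" using assms by simp
  define D where "D = arctan ((1 + v) / \<kappa>\<^sup>2) - arctan (v / \<kappa>\<^sup>2)"
  have eq: "smoothed_unit_interval (\<kappa>\<^sup>2) (1 + v) = D / pi"
    by (simp add: smoothed_unit_interval_def D_def arctan_minus)
  have pos: "0 < v / \<kappa>\<^sup>2" "v / \<kappa>\<^sup>2 \<le> (1 + v) / \<kappa>\<^sup>2"
    using v assms by (auto intro: divide_right_mono)
  have "D \<ge> 0" unfolding D_def using pos(2) by (simp add: arctan_le_iff)
  have D1: "D \<le> \<kappa>\<^sup>2 / v"
    using arctan_diff_bounds(1)[OF pos] by (simp add: D_def)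
  have D2: "D \<le> \<kappa>\<^sup>2 / v\<^sup>2"
  proof -
    have "((1 + v) / \<kappa>\<^sup>2 - v / \<kappa>\<^sup>2) / (v / \<kappa>\<^sup>2)\<^sup>2 = \<kappa>\<^sup>2 / v\<^sup>2"
      using assms(1) v by (simp add: field_simps power2_eq_square)
    then show ?thesis using arctan_diff_bounds(2)[OF pos] by (simp add: D_def)
  qed
  have "D * (1 + (1 + v)\<^sup>2) \<le> 5 * \<kappa>"
  proof (cases "v \<le> 1")
    case True
    have "\<kappa>\<^sup>2 / v \<le> \<kappa>"
      using assms v by (simp add: power2_eq_square field_simps mult_left_mono)
    moreover have "(1 + v)\<^sup>2 \<le> 2\<^sup>2" using True v by (intro power_mono) auto
    ultimately have "D * (1 + (1 + v)\<^sup>2) \<le> \<kappa> * 5"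
      using D1 \<open>D \<ge> 0\<close> assms by (intro mult_mono) auto
    then show ?thesis by simp
  next
    case False
    have "(1 + v)\<^sup>2 \<le> (2 * v)\<^sup>2" using False by (intro power_mono) auto
    moreover have "1 \<le> v\<^sup>2" using False by (simp add: one_le_power)
    ultimately have "1 + (1 + v)\<^sup>2 \<le> 5 * v\<^sup>2" by (simp add: power_mult_distrib)
    then have "D * (1 + (1 + v)\<^sup>2) \<le> \<kappa>\<^sup>2 / v\<^sup>2 * (5 * v\<^sup>2)"
      using D2 \<open>D \<ge> 0\<close> by (intro mult_mono) auto
    also have "\<dots> = 5 * \<kappa>\<^sup>2" using v by simp
    also have "\<dots> \<le> 5 * \<kappa>" using assms by (simp add: power2_eq_square mult_left_le)
    finally show ?thesis .
  qed
  then have "D \<le> 5 * \<kappa> / (1 + (1 + v)\<^sup>2)"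
    by (simp add: pos_le_divide_eq add_pos_nonneg)
  moreover have "D / pi \<le> D / 1"
    using \<open>D \<ge> 0\<close> pi_gt3 by (intro divide_left_mono) auto
  ultimately show ?thesis unfolding eq by linarith
qed

lemma smoothed_unit_interval_inside:
  assumes "0 < \<kappa>" "\<kappa> \<le> 1" "\<kappa> \<le> y" "y \<le> 1 - \<kappa>"
  shows "1 - smoothed_unit_interval (\<kappa>\<^sup>2) y \<le> \<kappa>"
proof -
  have tail: "pi / 2 - arctan (v / \<kappa>\<^sup>2) \<le> \<kappa>" if "v \<ge> \<kappa>" for v
  proof -
    have "pi / 2 - arctan (v / \<kappa>\<^sup>2) = arctan (1 / (v / \<kappa>\<^sup>2))"
      using arctan_inverse[of "v / \<kappa>\<^sup>2"] assms that by (simp add: inverse_eq_divide)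
    also have "\<dots> \<le> 1 / (v / \<kappa>\<^sup>2)"
      using assms that by (intro arctan_le_self) auto
    also have "\<dots> \<le> \<kappa>"
      using assms that by (simp add: power2_eq_square field_simps mult_left_mono)
    finally show ?thesis .
  qed
  have "pi - (arctan ((1 - y) / \<kappa>\<^sup>2) + arctan (y / \<kappa>\<^sup>2)) \<le> 2 * \<kappa>"
    using tail[of y] tail[of "1 - y"] assms by simp
  also have "\<dots> \<le> \<kappa> * pi"
    using pi_gt3 assms by simp
  finally show ?thesis
    by (simp add: smoothed_unit_interval_def field_simps)
qed

text \<open>The error of the smoothing is dominated by Poisson kernels again, with a small factor \<open>\<kappa>\<close>, so that its
  sum over the points is controlled by the same Stieltjes transforms. Within \<open>\<kappa>\<close> of an endpoint the error is
  only bounded by \<open>1\<close>, but there \<open>2 \<kappa>\<close> times the kernel of height \<open>\<kappa>\<close> at that endpoint exceeds \<open>1\<close>. Farther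
  away the error is at most \<open>\<kappa>\<close> and decays quadratically, which the kernel of height \<open>1\<close> dominates. Choosing
  the smoothing height \<open>\<kappa>\<^sup>2\<close> much smaller than the window \<open>\<kappa>\<close> makes both regimes work.\<close>

lemma unit_interval_smoothing_error:
  assumes \<kappa>: "0 < \<kappa>" "\<kappa> \<le> 1"
  shows "\<bar>indicator {0<..<1} y - smoothed_unit_interval (\<kappa>\<^sup>2) y\<bar>
    \<le> \<kappa> * (2 * poisson (Complex 0 \<kappa>) y + 2 * poisson (Complex 1 \<kappa>) y + 5 * poisson (Complex 0 1) y)"
proof -
  let ?e = "\<bar>indicator {0<..<1} y - smoothed_unit_interval (\<kappa>\<^sup>2) y\<bar>"
  let ?PA = "poisson (Complex 0 \<kappa>) y" and ?PB = "poisson (Complex 1 \<kappa>) y" and ?PC = "poisson (Complex 0 1) y"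
  have nonneg: "?PA \<ge> 0" "?PB \<ge> 0" "?PC \<ge> 0"
    using \<kappa> by (auto intro!: poisson_nonneg)
  have P: "?PC = 1 / (1 + y\<^sup>2)" by (simp add: poisson_eq add.commute)
  have eta: "\<kappa>\<^sup>2 > 0" using \<kappa> by simp
  note bounds = smoothed_unit_interval_bounds[OF eta, of y]
  have near: "1 \<le> 2 * (\<kappa> * poisson (Complex a \<kappa>) y)" if "\<bar>y - a\<bar> \<le> \<kappa>" for a
  proof -
    have "(y - a)\<^sup>2 \<le> \<kappa>\<^sup>2" using that \<kappa> by (simp add: abs_le_square_iff[symmetric])
    then have "(y - a)\<^sup>2 + \<kappa>\<^sup>2 \<le> 2 * \<kappa>\<^sup>2" by simp
    moreover have "2 * (\<kappa> * poisson (Complex a \<kappa>) y) = 2 * \<kappa>\<^sup>2 / ((y - a)\<^sup>2 + \<kappa>\<^sup>2)"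
      by (simp add: poisson_eq power2_eq_square)
    ultimately show ?thesis using eta by (simp add: le_divide_eq add_nonneg_pos)
  qed
  have split: "\<kappa> * (2 * ?PA + 2 * ?PB + 5 * ?PC) = 2 * (\<kappa> * ?PA) + 2 * (\<kappa> * ?PB) + 5 * \<kappa> * ?PC"
    by (simp add: algebra_simps)
  have prods: "\<kappa> * ?PA \<ge> 0" "\<kappa> * ?PB \<ge> 0" "5 * \<kappa> * ?PC \<ge> 0"
    using nonneg \<kappa> by auto
  have sym: "smoothed_unit_interval \<eta> (1 - u) = smoothed_unit_interval \<eta> u" for \<eta> u
    by (simp add: smoothed_unit_interval_def add.commute)
  have e1: "?e \<le> 1" using bounds by (auto simp: indicator_def)
  consider "\<bar>y - 0\<bar> \<le> \<kappa>" | "\<bar>y - 1\<bar> \<le> \<kappa>" | "\<kappa> \<le> y" "y \<le> 1 - \<kappa>" | "y \<ge> 1 + \<kappa>" | "y \<le> - \<kappa>"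
    by linarith
  then show ?thesis
  proof cases
    case 1
    from near[OF this] e1 prods show ?thesis unfolding split by linarith
  next
    case 2
    from near[OF this] e1 prods show ?thesis unfolding split by linarith
  next
    case 3
    then have "y \<in> {0<..<1}" using \<kappa> by auto
    then have "?e \<le> \<kappa>"
      using smoothed_unit_interval_inside[OF \<kappa> 3] bounds by (simp add: indicator_def)
    also have "\<dots> \<le> 5 * \<kappa> * ?PC"
    proof -
      have "y\<^sup>2 \<le> 1\<^sup>2" using 3 \<kappa> by (intro power_mono) auto
      then show ?thesis unfolding P using \<kappa> by (simp add: le_divide_eq add_pos_nonneg)
    qed
    finally show ?thesis unfolding split using prods by linarith
  next
    case 4
    then have "?e = smoothed_unit_interval (\<kappa>\<^sup>2) (1 + (y - 1))"
      using \<kappa> bounds by (simp add: indicator_def)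
    also have "\<dots> \<le> 5 * \<kappa> / (1 + (1 + (y - 1))\<^sup>2)"
      using 4 by (intro smoothed_unit_interval_outside \<kappa>) simp
    also have "\<dots> = 5 * \<kappa> * ?PC" by (simp add: P)
    finally show ?thesis unfolding split using prods by linarith
  next
    case 5
    then have "?e = smoothed_unit_interval (\<kappa>\<^sup>2) (1 + (- y))"
      using \<kappa> bounds sym[of "\<kappa>\<^sup>2" y] by (simp add: indicator_def)
    also have "\<dots> \<le> 5 * \<kappa> / (1 + (1 + (- y))\<^sup>2)"
      using 5 by (intro smoothed_unit_interval_outside \<kappa>) simp
    also have "\<dots> \<le> 5 * \<kappa> / (1 + y\<^sup>2)"
    proof (intro divide_left_mono)
      have "(- y)\<^sup>2 \<le> (1 + (- y))\<^sup>2" using 5 \<kappa> by (intro power_mono) auto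
      then show "1 + y\<^sup>2 \<le> 1 + (1 + (- y))\<^sup>2" by simp
    qed (use \<kappa> in \<open>auto intro!: mult_pos_pos add_pos_nonneg\<close>)
    also have "\<dots> = 5 * \<kappa> * ?PC" by (simp add: P)
    finally show ?thesis unfolding split using prods by linarith
  qed
qed

lemma poisson_integral_unit_interval:
  assumes "\<eta> > 0"
  shows "(\<integral>u. poisson (Complex u \<eta>) y \<partial>(restrict_space lborel {0..1})) = pi * smoothed_unit_interval \<eta> y"
proof -
  have "(\<integral>u. poisson (Complex u \<eta>) y \<partial>(restrict_space lborel {0..1}))
      = (LBINT u. indicator {0..1} u *\<^sub>R poisson (Complex u \<eta>) y)"
    by (rule integral_restrict_space) simp
  also have "\<dots> = arctan ((1 - y) / \<eta>) - arctan ((0 - y) / \<eta>)"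
  proof (rule integral_FTC_Icc)
    show "((\<lambda>u. arctan ((u - y) / \<eta>)) has_vector_derivative poisson (Complex u \<eta>) y) (at u within {0..1})" for u
    proof -
      have "((\<lambda>u. arctan ((u - y) / \<eta>)) has_real_derivative inverse (1 + ((u - y) / \<eta>)\<^sup>2) * (1 / \<eta>)) (at u)"
        using assms by (auto intro!: derivative_eq_intros)
      moreover have "inverse (1 + ((u - y) / \<eta>)\<^sup>2) * (1 / \<eta>) = poisson (Complex u \<eta>) y"
      proof -
        have "1 + ((u - y) / \<eta>)\<^sup>2 = ((y - u)\<^sup>2 + \<eta>\<^sup>2) / \<eta>\<^sup>2"
          using assms by (simp add: power_divide add_divide_distrib power2_commute[of u y])
        then show ?thesis
          using assms by (simp add: poisson_eq power2_eq_square)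
      qed
      ultimately have "((\<lambda>u. arctan ((u - y) / \<eta>)) has_real_derivative poisson (Complex u \<eta>) y) (at u)"
        by (simp only:)
      from has_field_derivative_at_within[OF this] show ?thesis
        unfolding has_real_derivative_iff_has_vector_derivative .
    qed
    have "(y - u)\<^sup>2 + \<eta>\<^sup>2 \<noteq> 0" for u using assms by (simp add: sum_power2_eq_zero_iff)
    then show "continuous_on {0..1} (\<lambda>u. poisson (Complex u \<eta>) y)"
      unfolding poisson_eq complex.sel by (intro continuous_intros ballI)
  qed simp
  also have "\<dots> = pi * smoothed_unit_interval \<eta> y"
    by (simp add: smoothed_unit_interval_def arctan_minus)
  finally show ?thesis .
qed

section \<open>The local semicircle law\<close>

text \<open>Centre at \<open>x sqrt n\<close> and rescale by the interval length \<open>t / sqrt n\<close>, so that the counting interval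
  becomes the unit interval. At the spectral parameter \<open>x + (t/n) \<zeta>\<close> with \<open>\<zeta>\<close> fixed, the Stieltjes
  transform then is \<open>1/t\<close> times the resolvent sum of the rescaled points at \<open>\<zeta>\<close>.\<close>

lemma emp_stieltjes_rescaled:
  assumes "n \<ge> 1" "t > 0"
  shows "emp_stieltjes n (of_real x + of_real (t / n) * \<zeta>) y
    = (\<Sum>i\<in>{1..n}. resolvent \<zeta> ((y i - x * sqrt n) / (t / sqrt n))) / of_real t"
proof -
  define r where "r = sqrt n"
  have r: "r > 0" "n = r * r" using assms(1) by (simp_all add: r_def)
  have "of_real r * (of_real x + of_real (t / n) * \<zeta>) = of_real (x * r) + of_real (t / r) * \<zeta>"
    using r(1) unfolding r(2) by (simp add: field_simps)
  then have "resolvent (of_real r * (of_real x + of_real (t / n) * \<zeta>)) v / of_real r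
      = resolvent \<zeta> ((v - x * r) / (t / r)) / of_real t" for v
  proof -
    assume eq: "of_real r * (of_real x + of_real (t / n) * \<zeta>) = of_real (x * r) + of_real (t / r) * \<zeta>"
    have "of_real v - (of_real (x * r) + of_real (t / r) * \<zeta>)
        = of_real (t / r) * (of_real ((v - x * r) / (t / r)) - \<zeta>)"
      using r(1) assms(2) by (simp add: field_simps)
    then show ?thesis
      unfolding resolvent_def eq using r(1) assms(2) by simp
  qed
  then show ?thesis
    unfolding emp_stieltjes_def stieltjes_sum_def r_def[symmetric] by (simp add: sum_divide_distrib)
qed

lemma num_points_rescaled:
  assumes "n \<ge> 1" "t > 0"
  shows "real (num_points n \<Lambda> (x * sqrt n) (x * sqrt n + t / sqrt n) \<omega>)
    = (\<Sum>i\<in>{1..n}. indicator {0<..<1} ((\<Lambda> i \<omega> - x * sqrt n) / (t / sqrt n)))"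
proof -
  have pos: "t / sqrt n > 0" using assms by simp
  have mem: "(v - x * sqrt n) / (t / sqrt n) \<in> {0<..<1} \<longleftrightarrow> v \<in> {x * sqrt n<..<x * sqrt n + t / sqrt n}" for v
  proof -
    have "(v - a) / c \<in> {0<..<1} \<longleftrightarrow> v \<in> {a<..<a + c}" if "c > 0" for a c :: real
      using that by (auto simp: zero_less_divide_iff divide_less_eq)
    from this[OF pos] show ?thesis .
  qed
  have "(\<Sum>i\<in>{1..n}. indicator {0<..<1} ((\<Lambda> i \<omega> - x * sqrt n) / (t / sqrt n)) :: real)
      = (\<Sum>i\<in>{1..n}. if \<Lambda> i \<omega> \<in> {x * sqrt n<..<x * sqrt n + t / sqrt n} then 1 else 0)"
    unfolding indicator_def of_bool_def mem ..
  also have "\<dots> = real (card {i \<in> {1..n}. \<Lambda> i \<omega> \<in> {x * sqrt n<..<x * sqrt n + t / sqrt n}})"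
    by (subst sum.inter_filter[symmetric]) auto
  finally show ?thesis by (simp add: num_points_def)
qed

lemma prob_space_unit_interval: "prob_space (restrict_space lborel {0..1::real})"
  by (intro prob_spaceI) (simp add: space_restrict_space emeasure_restrict_space)

text \<open>The deviation is bounded by a random variable \<open>Z\<close> built from Stieltjes transforms at parameters
  \<open>x + (t/n) \<zeta>\<close> with \<open>\<zeta>\<close> in a bounded set at height at least \<open>\<kappa>\<^sup>2\<close>. On this set they are all
  within \<open>\<kappa>\<close> of \<open>m = Im (sc_boundary x)\<close> in mean, uniformly. The smoothed count contributes the average
  over \<open>u \<in> [0, 1]\<close> of deviations at \<open>\<zeta> = u + i \<kappa>\<^sup>2\<close>, hence at most \<open>\<kappa>\<close> to the mean of \<open>Z\<close>. The smoothing error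
  contributes \<open>\<kappa>\<close> times Stieltjes transforms with weights \<open>2 + 2 + 5 = 9\<close> and means at most \<open>m + \<kappa> \<le> 2\<close>,
  hence at most \<open>18 \<kappa>\<close>. Markov's inequality concludes.\<close>

lemma counting_deviation_probability:
  assumes "\<beta> > 0" "- 2 < x" "x < 2" "\<epsilon> > 0" and \<kappa>: "0 < \<kappa>" "\<kappa> \<le> 1"
  obtains \<tau> :: real where "\<tau> > 0"
    "\<And>n (M :: 'a measure) \<Lambda> t. n \<ge> 1 \<Longrightarrow> hermite_ensemble \<beta> n M \<Lambda> \<Longrightarrow> t > 0 \<Longrightarrow>
       1 / (t * \<kappa>\<^sup>2)\<^sup>2 + (2 * t / n)\<^sup>2 \<le> \<tau> \<Longrightarrow>
       measure M {\<omega> \<in> space M. \<bar>real (num_points n \<Lambda> (x * sqrt n) (x * sqrt n + t / sqrt n) \<omega>) / t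
          - rho_sc x\<bar> > \<epsilon>} \<le> 19 * \<kappa> / \<epsilon>"
proof -
  obtain \<tau> where \<tau>: "\<tau> > 0"
    "\<And>n (M :: 'a measure) \<Lambda> w. n \<ge> 1 \<Longrightarrow> hermite_ensemble \<beta> n M \<Lambda> \<Longrightarrow> Im w > 0 \<Longrightarrow>
       1 / (n * Im w)\<^sup>2 + (norm (w - of_real x))\<^sup>2 \<le> \<tau> \<Longrightarrow>
       (\<integral>\<omega>. norm (emp_stieltjes n w (\<lambda>i. \<Lambda> i \<omega>) - sc_boundary x) \<partial>M) \<le> \<kappa>"
    by (rule emp_stieltjes_L1[OF assms(1-3) \<kappa>(1)]) (rule that)
  show thesis
  proof (rule that[OF \<tau>(1)])
    fix n :: nat and M :: "'a measure" and \<Lambda> t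
    assume n: "n \<ge> 1" and ens: "hermite_ensemble \<beta> n M \<Lambda>" and t: "t > 0"
      and small: "1 / (t * \<kappa>\<^sup>2)\<^sup>2 + (2 * t / n)\<^sup>2 \<le> \<tau>"
    interpret prob_space M using ens by (simp add: hermite_ensemble_def)
    define \<eta> where "\<eta> = \<kappa>\<^sup>2"
    have \<eta>: "\<eta> > 0" "\<eta> \<le> \<kappa>" using \<kappa> by (auto simp: \<eta>_def power2_eq_square mult_left_le)
    define m where "m = Im (sc_boundary x)"
    have m: "0 < m" "m \<le> 1"
      using sc_boundary(1,2)[OF assms(2,3)] abs_Im_le_cmod[of "sc_boundary x"] by (auto simp: m_def)
    define Y where "Y = (\<lambda>i \<omega>. (\<Lambda> i \<omega> - x * sqrt n) / (t / sqrt n))"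
    define F where "F = (\<lambda>\<zeta> \<omega>. (\<Sum>i\<in>{1..n}. poisson \<zeta> (Y i \<omega>)) / t)"
    define W where "W = (\<lambda>\<zeta>. of_real x + of_real (t / n) * \<zeta> :: complex)"
    have F_eq: "F \<zeta> \<omega> = Im (emp_stieltjes n (W \<zeta>) (\<lambda>i. \<Lambda> i \<omega>))" for \<zeta> \<omega>
      unfolding emp_stieltjes_rescaled[OF n t] F_def W_def Y_def
      by (simp add: Im_divide_of_real poisson_def)
    have F_nonneg: "F \<zeta> \<omega> \<ge> 0" if "Im \<zeta> \<ge> 0" for \<zeta> \<omega>
      unfolding F_def using t that by (intro divide_nonneg_pos sum_nonneg poisson_nonneg)
    have L1: "integrable M (F \<zeta>)" "(\<integral>\<omega>. \<bar>F \<zeta> \<omega> - m\<bar> \<partial>M) \<le> \<kappa>"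
      if \<zeta>: "Im \<zeta> \<ge> \<eta>" "norm \<zeta> \<le> 2" for \<zeta>
    proof -
      have W: "Im (W \<zeta>) > 0"
        using \<zeta>(1) \<eta> t n by (simp add: W_def)
      have int: "integrable M (\<lambda>\<omega>. emp_stieltjes n (W \<zeta>) (\<lambda>i. \<Lambda> i \<omega>))"
        by (rule emp_stieltjes_integrable[OF ens n W])
      show F_int: "integrable M (F \<zeta>)"
        using integrable_Im[OF int] by (simp add: F_eq[abs_def])
      have "(\<integral>\<omega>. \<bar>F \<zeta> \<omega> - m\<bar> \<partial>M) \<le> (\<integral>\<omega>. norm (emp_stieltjes n (W \<zeta>) (\<lambda>i. \<Lambda> i \<omega>) - sc_boundary x) \<partial>M)"
      proof (rule integral_mono)
        show "integrable M (\<lambda>\<omega>. \<bar>F \<zeta> \<omega> - m\<bar>)"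
          using F_int by (intro integrable_abs Bochner_Integration.integrable_diff) auto
        show "integrable M (\<lambda>\<omega>. norm (emp_stieltjes n (W \<zeta>) (\<lambda>i. \<Lambda> i \<omega>) - sc_boundary x))"
          using int by (intro integrable_norm Bochner_Integration.integrable_diff) auto
        show "\<bar>F \<zeta> \<omega> - m\<bar> \<le> norm (emp_stieltjes n (W \<zeta>) (\<lambda>i. \<Lambda> i \<omega>) - sc_boundary x)" for \<omega>
          unfolding F_eq m_def minus_complex.sel(2)[symmetric] by (rule abs_Im_le_cmod)
      qed
      also have "\<dots> \<le> \<kappa>"
      proof (rule \<tau>(2)[OF n ens W])
        have nW: "n * Im (W \<zeta>) = t * Im \<zeta>" using n by (simp add: W_def)
        have "1 / (t * Im \<zeta>)\<^sup>2 \<le> 1 / (t * \<eta>)\<^sup>2"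
          using t \<eta> \<zeta>(1) by (intro divide_left_mono power_mono mult_left_mono mult_pos_pos) auto
        moreover have "(norm (W \<zeta> - of_real x))\<^sup>2 \<le> (2 * t / n)\<^sup>2"
        proof (rule power_mono)
          have "norm (W \<zeta> - of_real x) = t / n * norm \<zeta>"
            using t by (simp add: W_def norm_mult norm_divide)
          also have "\<dots> \<le> t / n * 2" using t \<zeta>(2) by (intro mult_left_mono) auto
          finally show "norm (W \<zeta> - of_real x) \<le> 2 * t / n" by (simp add: mult.commute)
        qed simp
        ultimately show "1 / (n * Im (W \<zeta>))\<^sup>2 + (norm (W \<zeta> - of_real x))\<^sup>2 \<le> \<tau>"
          unfolding nW using small unfolding \<eta>_def by linarith
      qed
      finally show "(\<integral>\<omega>. \<bar>F \<zeta> \<omega> - m\<bar> \<partial>M) \<le> \<kappa>" .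
    qed
    have mean: "(\<integral>\<omega>. F \<zeta> \<omega> \<partial>M) \<le> 2" if \<zeta>: "Im \<zeta> \<ge> \<eta>" "norm \<zeta> \<le> 2" for \<zeta>
    proof -
      have "(\<integral>\<omega>. F \<zeta> \<omega> \<partial>M) \<le> (\<integral>\<omega>. \<bar>F \<zeta> \<omega> - m\<bar> + m \<partial>M)"
        using L1(1)[OF \<zeta>] by (intro integral_mono) auto
      also have "\<dots> = (\<integral>\<omega>. \<bar>F \<zeta> \<omega> - m\<bar> \<partial>M) + m"
        using L1(1)[OF \<zeta>] by (simp add: prob_space)
      finally show ?thesis using L1(2)[OF \<zeta>] m \<kappa> by linarith
    qed

    let ?U = "restrict_space lborel {0..1::real}"
    interpret U: prob_space ?U by (rule prob_space_unit_interval)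
    interpret UM: pair_prob_space ?U M ..
    define f where "f = (\<lambda>u \<omega>. \<bar>F (Complex u \<eta>) \<omega> - m\<bar>)"
    have f_int: "integrable (?U \<Otimes>\<^sub>M M) (case_prod f)"
    proof (rule UM.integrable_const_bound[of _ "real n / \<eta> / t + 1"])
      have "f u \<omega> \<le> real n / \<eta> / t + 1" for u \<omega>
      proof -
        have "poisson (Complex u \<eta>) v \<le> 1 / \<eta>" for v
          unfolding poisson_def using norm_resolvent_le[of "Complex u \<eta>" v] \<eta>(1)
            abs_Im_le_cmod[of "resolvent (Complex u \<eta>) v"] by simp
        then have "(\<Sum>i\<in>{1..n}. poisson (Complex u \<eta>) (Y i \<omega>)) \<le> of_nat (card {1..n}) * (1 / \<eta>)"
          by (intro sum_bounded_above)
        then have "F (Complex u \<eta>) \<omega> \<le> real n / \<eta> / t"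
          unfolding F_def using t by (intro divide_right_mono) auto
        moreover have "F (Complex u \<eta>) \<omega> \<ge> 0" using \<eta> by (intro F_nonneg) simp
        ultimately show ?thesis unfolding f_def using m by linarith
      qed
      then show "AE p in ?U \<Otimes>\<^sub>M M. norm (case_prod f p) \<le> real n / \<eta> / t + 1"
        by (auto simp: f_def)
      have [measurable]: "(\<lambda>p. fst p) \<in> borel_measurable (?U \<Otimes>\<^sub>M M)"
        by (rule measurable_compose[OF measurable_fst]) (auto intro: measurable_restrict_space1)
      have [measurable]: "Y i \<in> borel_measurable M" if "i \<in> {1..n}" for i
        using hermite_ensemble_measurable[OF ens that] unfolding Y_def by measurable
      show "case_prod f \<in> borel_measurable (?U \<Otimes>\<^sub>M M)"
        unfolding split_def f_def F_def poisson_eq complex.sel by measurable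
    qed
    define g where "g = (\<lambda>\<omega>. \<integral>u. f u \<omega> \<partial>?U)"
    have g_int: "integrable M g"
      unfolding g_def by (rule UM.integrable_snd[OF f_int])
    have g_le: "(\<integral>\<omega>. g \<omega> \<partial>M) \<le> \<kappa>"
    proof -
      have "(\<integral>\<omega>. g \<omega> \<partial>M) = (\<integral>u. (\<integral>\<omega>. f u \<omega> \<partial>M) \<partial>?U)"
        unfolding g_def by (rule UM.Fubini_integral[OF f_int])
      also have "\<dots> \<le> (\<integral>u. \<kappa> \<partial>?U)"
      proof (rule integral_mono)
        show "integrable ?U (\<lambda>u. \<integral>\<omega>. f u \<omega> \<partial>M)" by (rule UM.integrable_fst[OF f_int])
        fix u assume "u \<in> space ?U"
        then have u: "0 \<le> u" "u \<le> 1" by (auto simp: space_restrict_space)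
        have "norm (Complex u \<eta>) \<le> 2"
          using cmod_le[of "Complex u \<eta>"] u \<eta> \<kappa> by simp
        then show "(\<integral>\<omega>. f u \<omega> \<partial>M) \<le> \<kappa>"
          unfolding f_def by (intro L1(2)) auto
      qed simp
      also have "\<dots> = \<kappa>" using U.prob_space by simp
      finally show ?thesis .
    qed

    define Z where "Z = (\<lambda>\<omega>. g \<omega> / pi + \<kappa> * (2 * F (Complex 0 \<kappa>) \<omega> + 2 * F (Complex 1 \<kappa>) \<omega> + 5 * F (Complex 0 1) \<omega>))"
    have good: "Im (Complex 0 \<kappa>) \<ge> \<eta>" "norm (Complex 0 \<kappa>) \<le> 2" "Im (Complex 1 \<kappa>) \<ge> \<eta>" "norm (Complex 1 \<kappa>) \<le> 2"
        "Im (Complex 0 1) \<ge> \<eta>" "norm (Complex 0 1) \<le> 2"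
      using cmod_le[of "Complex 0 \<kappa>"] cmod_le[of "Complex 1 \<kappa>"] cmod_le[of "Complex 0 1"] \<eta> \<kappa> by auto
    note F_ints = L1(1)[OF good(1,2)] L1(1)[OF good(3,4)] L1(1)[OF good(5,6)]
    have Z_int: "integrable M Z"
      unfolding Z_def using g_int F_ints by simp
    have Z_le: "(\<integral>\<omega>. Z \<omega> \<partial>M) \<le> 19 * \<kappa>"
    proof -
      have "(\<integral>\<omega>. Z \<omega> \<partial>M) = (\<integral>\<omega>. g \<omega> \<partial>M) / pi + \<kappa> * (2 * (\<integral>\<omega>. F (Complex 0 \<kappa>) \<omega> \<partial>M)
          + 2 * (\<integral>\<omega>. F (Complex 1 \<kappa>) \<omega> \<partial>M) + 5 * (\<integral>\<omega>. F (Complex 0 1) \<omega> \<partial>M))"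
        unfolding Z_def using g_int F_ints by simp
      also have "\<dots> \<le> \<kappa> / 1 + \<kappa> * (2 * 2 + 2 * 2 + 5 * 2)"
        using g_le \<kappa> pi_gt3 mean[OF good(1,2)] mean[OF good(3,4)] mean[OF good(5,6)]
        by (intro add_mono mult_left_mono frac_le) auto
      finally show ?thesis by simp
    qed
    have dev: "\<bar>real (num_points n \<Lambda> (x * sqrt n) (x * sqrt n + t / sqrt n) \<omega>) / t - rho_sc x\<bar> \<le> Z \<omega>"
      if \<omega>: "\<omega> \<in> space M" for \<omega>
    proof -
      let ?N = "real (num_points n \<Lambda> (x * sqrt n) (x * sqrt n + t / sqrt n) \<omega>)"
      let ?A = "\<Sum>i\<in>{1..n}. smoothed_unit_interval \<eta> (Y i \<omega>)"
      have N: "?N = (\<Sum>i\<in>{1..n}. indicator {0<..<1} (Y i \<omega>))"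
        unfolding Y_def by (rule num_points_rescaled[OF n t])
      have "\<bar>?N - ?A\<bar> \<le> (\<Sum>i\<in>{1..n}. \<bar>indicator {0<..<1} (Y i \<omega>) - smoothed_unit_interval \<eta> (Y i \<omega>)\<bar>)"
        unfolding N sum_subtractf[symmetric] by (rule sum_abs)
      also have "\<dots> \<le> (\<Sum>i\<in>{1..n}. \<kappa> * (2 * poisson (Complex 0 \<kappa>) (Y i \<omega>)
          + 2 * poisson (Complex 1 \<kappa>) (Y i \<omega>) + 5 * poisson (Complex 0 1) (Y i \<omega>)))"
        unfolding \<eta>_def by (intro sum_mono unit_interval_smoothing_error \<kappa>)
      also have "\<dots> = t * (\<kappa> * (2 * F (Complex 0 \<kappa>) \<omega> + 2 * F (Complex 1 \<kappa>) \<omega> + 5 * F (Complex 0 1) \<omega>))"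
        unfolding F_def using t by (simp add: sum_distrib_left sum.distrib field_simps)
      finally have "\<bar>?N / t - ?A / t\<bar> \<le> \<kappa> * (2 * F (Complex 0 \<kappa>) \<omega> + 2 * F (Complex 1 \<kappa>) \<omega> + 5 * F (Complex 0 1) \<omega>)"
        using t by (simp add: diff_divide_distrib[symmetric] abs_divide divide_le_eq mult.commute)
      moreover have "\<bar>?A / t - rho_sc x\<bar> \<le> g \<omega> / pi"
      proof -
        have P_int: "integrable ?U (\<lambda>u. poisson (Complex u \<eta>) v)" for v
        proof (rule U.integrable_const_bound[of _ "1 / \<eta>"])
          have "norm (poisson (Complex u \<eta>) v) \<le> 1 / \<eta>" for u
            unfolding poisson_def using norm_resolvent_le[of "Complex u \<eta>" v] \<eta>(1)
              abs_Im_le_cmod[of "resolvent (Complex u \<eta>) v"] by simp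
          then show "AE u in ?U. norm (poisson (Complex u \<eta>) v) \<le> 1 / \<eta>" by simp
          have [measurable]: "(\<lambda>u. u) \<in> borel_measurable ?U" by (auto intro: measurable_restrict_space1)
          show "(\<lambda>u. poisson (Complex u \<eta>) v) \<in> borel_measurable ?U"
            unfolding poisson_eq complex.sel by measurable
        qed
        have "(\<integral>u. F (Complex u \<eta>) \<omega> - m \<partial>?U) = (\<Sum>i\<in>{1..n}. (\<integral>u. poisson (Complex u \<eta>) (Y i \<omega>) \<partial>?U)) / t - m"
          unfolding F_def using P_int U.prob_space by simp
        also have "\<dots> = pi * (?A / t) - m"
          by (simp add: poisson_integral_unit_interval[OF \<eta>(1)] sum_distrib_left)
        finally have smooth: "(\<integral>u. F (Complex u \<eta>) \<omega> - m \<partial>?U) = pi * (?A / t) - m" .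
        have "m = pi * rho_sc x"
        proof -
          have "\<bar>x\<bar> \<le> 2" using assms(2,3) by linarith
          then show ?thesis by (simp add: m_def sc_boundary_def rho_sc_def)
        qed
        then have "\<bar>pi * (?A / t) - pi * rho_sc x\<bar> = \<bar>\<integral>u. F (Complex u \<eta>) \<omega> - m \<partial>?U\<bar>"
          unfolding smooth by simp
        also have "\<dots> \<le> g \<omega>"
          unfolding g_def f_def by (rule integral_abs_bound)
        finally have "pi * \<bar>?A / t - rho_sc x\<bar> \<le> g \<omega>"
          by (simp only: right_diff_distrib[symmetric] abs_mult) simp
        then show ?thesis by (simp add: field_simps)
      qed
      ultimately show ?thesis unfolding Z_def by linarith
    qed
    have "measure M {\<omega> \<in> space M. \<bar>real (num_points n \<Lambda> (x * sqrt n) (x * sqrt n + t / sqrt n) \<omega>) / t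
          - rho_sc x\<bar> > \<epsilon>} \<le> measure M {\<omega> \<in> space M. Z \<omega> \<ge> \<epsilon>}"
      using dev borel_measurable_integrable[OF Z_int]
      by (intro finite_measure_mono) (auto intro: order_trans less_imp_le)
    also have "\<dots> \<le> (\<integral>\<omega>. Z \<omega> \<partial>M) / \<epsilon>"
      using dev by (intro integral_Markov_inequality_measure[where A = "{}"] Z_int assms(4) AE_I2)
        (auto intro: order_trans[OF abs_ge_zero])
    also have "\<dots> \<le> 19 * \<kappa> / \<epsilon>"
      using Z_le assms(4) by (intro divide_right_mono) auto
    finally show "measure M {\<omega> \<in> space M. \<bar>real (num_points n \<Lambda> (x * sqrt n) (x * sqrt n + t / sqrt n) \<omega>) / t
          - rho_sc x\<bar> > \<epsilon>} \<le> 19 * \<kappa> / \<epsilon>" .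
  qed
qed

theorem theorem1p1:
  fixes \<beta> x \<epsilon> :: real
    and M :: "nat \<Rightarrow> 'a measure"
    and \<Lambda> :: "nat \<Rightarrow> nat \<Rightarrow> 'a \<Rightarrow> real"
    and t :: "nat \<Rightarrow> real"
  assumes "\<beta> > 0"
    and "\<And>n. n \<ge> 1 \<Longrightarrow> hermite_ensemble \<beta> n (M n) (\<Lambda> n)"
    and "filterlim (\<lambda>n. t n / sqrt (ln (real n))) at_top sequentially"
    and "(\<lambda>n. t n / sqrt (real n)) \<longlonglongrightarrow> 0"
    and "- 2 < x" and "x < 2" and "\<epsilon> > 0"
  shows "(\<lambda>n. measure (M n) {\<omega> \<in> space (M n).
            \<bar>real (num_points n (\<Lambda> n) (x * sqrt (real n)) (x * sqrt (real n) + t n / sqrt (real n)) \<omega>) / t n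
              - rho_sc x\<bar> > \<epsilon>}) \<longlonglongrightarrow> 0"
proof -
  have t_top: "filterlim t at_top sequentially"
  proof (rule filterlim_at_top_mono[OF assms(3)])
    have "\<forall>\<^sub>F n in sequentially. t n / sqrt (ln (real n)) \<ge> 0"
      using assms(3) by (simp add: filterlim_at_top)
    moreover have "\<forall>\<^sub>F n in sequentially. ln (real n) \<ge> 1"
      using filterlim_compose[OF ln_at_top filterlim_real_sequentially] by (simp add: filterlim_at_top)
    ultimately show "\<forall>\<^sub>F n in sequentially. t n / sqrt (ln (real n)) \<le> t n"
    proof eventually_elim
      case (elim n)
      then have "1 \<le> sqrt (ln (real n))" by simp
      moreover from this elim have "t n \<ge> 0" by (simp add: zero_le_divide_iff)
      ultimately show ?case
        using divide_left_mono[of 1 "sqrt (ln (real n))" "t n"] by simp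
    qed
  qed
  have t_small: "(\<lambda>n. t n / real n) \<longlonglongrightarrow> 0"
  proof -
    have "(\<lambda>n. 1 / sqrt (real n)) \<longlonglongrightarrow> 0"
      by (intro tendsto_divide_0[OF tendsto_const] filterlim_at_top_imp_at_infinity
          filterlim_compose[OF sqrt_at_top filterlim_real_sequentially])
    from tendsto_mult[OF assms(4) this] show ?thesis
      by simp
  qed
  show ?thesis
  proof (rule tendstoI)
    fix r :: real assume r: "r > 0"
    \<comment> \<open>With this choice the probability bound \<open>19 * \<kappa> / \<epsilon>\<close> is at most \<open>r / 2\<close>.\<close>
    define \<kappa> where "\<kappa> = min 1 (r * \<epsilon> / 38)"
    have \<kappa>: "0 < \<kappa>" "\<kappa> \<le> 1" "\<kappa> \<le> r * \<epsilon> / 38"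
      using r assms(7) by (auto simp: \<kappa>_def)
    obtain \<tau> where \<tau>: "\<tau> > 0"
      "\<And>n (M :: 'a measure) \<Lambda> t. n \<ge> 1 \<Longrightarrow> hermite_ensemble \<beta> n M \<Lambda> \<Longrightarrow> t > 0 \<Longrightarrow>
         1 / (t * \<kappa>\<^sup>2)\<^sup>2 + (2 * t / n)\<^sup>2 \<le> \<tau> \<Longrightarrow>
         measure M {\<omega> \<in> space M. \<bar>real (num_points n \<Lambda> (x * sqrt n) (x * sqrt n + t / sqrt n) \<omega>) / t
            - rho_sc x\<bar> > \<epsilon>} \<le> 19 * \<kappa> / \<epsilon>"
      by (rule counting_deviation_probability[OF assms(1,5,6,7) \<kappa>(1,2)]) (rule that)
    \<comment> \<open>\<open>\<tau>\<close> depends on \<open>\<kappa>\<close> but not on \<open>n\<close>, so the smallness condition holds for all large \<open>n\<close>.\<close>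
    have "(\<lambda>n. 1 / (t n * \<kappa>\<^sup>2)\<^sup>2 + (2 * t n / n)\<^sup>2) \<longlonglongrightarrow> 0 + (2 * 0)\<^sup>2"
    proof (intro tendsto_add)
      have "filterlim (\<lambda>n. \<kappa>\<^sup>2 * t n) at_top sequentially"
        using \<kappa>(1) by (intro filterlim_tendsto_pos_mult_at_top[OF tendsto_const _ t_top]) simp
      then have "filterlim (\<lambda>n. (\<kappa>\<^sup>2 * t n)\<^sup>2) at_top sequentially"
        by (intro filterlim_pow_at_top) simp_all
      then show "(\<lambda>n. 1 / (t n * \<kappa>\<^sup>2)\<^sup>2) \<longlonglongrightarrow> 0"
        unfolding mult.commute[of "t _"]
        by (intro tendsto_divide_0[OF tendsto_const] filterlim_at_top_imp_at_infinity)
      show "(\<lambda>n. (2 * t n / n)\<^sup>2) \<longlonglongrightarrow> (2 * 0)\<^sup>2"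
        unfolding times_divide_eq_right[symmetric] by (intro tendsto_power tendsto_mult tendsto_const t_small)
    qed
    then have "\<forall>\<^sub>F n in sequentially. 1 / (t n * \<kappa>\<^sup>2)\<^sup>2 + (2 * t n / n)\<^sup>2 < \<tau>"
      using \<tau>(1) by (intro order_tendstoD(2)) auto
    moreover have "\<forall>\<^sub>F n in sequentially. t n > 0"
      using t_top by (simp add: filterlim_at_top_dense)
    ultimately show "\<forall>\<^sub>F n in sequentially. dist (measure (M n) {\<omega> \<in> space (M n).
        \<bar>real (num_points n (\<Lambda> n) (x * sqrt (real n)) (x * sqrt (real n) + t n / sqrt (real n)) \<omega>) / t n
          - rho_sc x\<bar> > \<epsilon>}) 0 < r"
      using eventually_ge_at_top[of 1]
    proof eventually_elim
      case (elim n)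
      have "measure (M n) {\<omega> \<in> space (M n).
        \<bar>real (num_points n (\<Lambda> n) (x * sqrt (real n)) (x * sqrt (real n) + t n / sqrt (real n)) \<omega>) / t n
          - rho_sc x\<bar> > \<epsilon>} \<le> 19 * \<kappa> / \<epsilon>"
        using elim by (intro \<tau>(2) assms(2)) auto
      also have "\<dots> \<le> r / 2"
        using \<kappa>(3) assms(7) by (simp add: divide_le_eq)
      also have "\<dots> < r" using r by simp
      finally show ?case by simp
    qed
  qed
qed

end
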